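(* Let $R$ be a Noetherian local ring, let $M$ be a non-zero finitely generated $R$-module of dimension $d\ge 1$, and let $(y_1,\dots,y_d)$ be a reducing system of parameters of $M$. Then $M$ is a Cohen--Macaulay module if and only if $y_d$ is a non zero divisor on $M/(y_1,\dots,y_{d-1})M$.
   Context: Let $\mathfrak m$ be the maximal ideal of $R$. A system of parameters of $M$ (with $d=\dim M$) is a sequence $(x_1,\dots,x_d)$ of elements of $\mathfrak m$ such that $M/(x_1,\dots,x_d)M$ has finite length. A system of parameters $(x_1,\dots,x_d)$ of $M$ is called reducing if for all $i=1,\dots,d-1$ one has $x_i\notin P$ for every $P\in\operatorname{Ass} M/(x_1,\dots,x_{i-1})M$ with $\dim R/P=d-i$. $M$ is Cohen--Macaulay if $\operatorname{depth} M=\dim M$. *)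

theory Defs
  imports "HOL-Library.Extended_Nat" "HOL-Algebra.Module" "HOL-Algebra.QuotRing"
    "HOL-Algebra.Ring_Divisibility"
begin

section \<open>Noetherian local rings and Krull dimension\<close>

locale noetherian_local_ring = cring R + noetherian_ring R for R (structure) +
  assumes unique_maximalideal: "\<exists>!I. maximalideal I R"

definition max_ideal :: "('a, 'r) ring_scheme \<Rightarrow> 'a set" where
  "max_ideal R = (THE I. maximalideal I R)"

text \<open>
  The zero ring has no prime ideals and receives the value \<open>0\<close> here, since \<open>Sup {} = 0\<close>
  in \<^typ>\<open>enat\<close>; for every non-zero ring this is the usual Krull dimension.
\<close>

definition krull_dim :: "('a, 'r) ring_scheme \<Rightarrow> enat" where
  "krull_dim R = Sup {enat n | n. \<exists>P :: nat \<Rightarrow> 'a set.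
     (\<forall>i\<le>n. primeideal (P i) R) \<and> (\<forall>i<n. P i \<subset> P (Suc i))}"


section \<open>Modules\<close>

definition submodule_span ::
  "('a, 'r) ring_scheme \<Rightarrow> ('a, 'b, 'm) module_scheme \<Rightarrow> 'b set \<Rightarrow> 'b set" where
  "submodule_span R M S = \<Inter>{N. submodule N R M \<and> S \<subseteq> N}"

definition fin_gen_module ::
  "('a, 'r) ring_scheme \<Rightarrow> ('a, 'b, 'm) module_scheme \<Rightarrow> bool" where
  "fin_gen_module R M \<longleftrightarrow>
     (\<exists>S. finite S \<and> S \<subseteq> carrier M \<and> submodule_span R M S = carrier M)"

definition ideal_times ::
  "('a, 'r) ring_scheme \<Rightarrow> ('a, 'b, 'm) module_scheme \<Rightarrow> 'a set \<Rightarrow> 'b set" where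
  "ideal_times R M I = submodule_span R M {a \<odot>\<^bsub>M\<^esub> u | a u. a \<in> I \<and> u \<in> carrier M}"

text \<open>
  The record type of modules extends that of rings, but \<^locale>\<open>module\<close> does not refer to
  the fields \<open>monoid.mult\<close> and \<open>monoid.one\<close> of the module; they are left unspecified.
  Scalar multiplication on cosets follows the pattern of \<^const>\<open>rcoset_mult\<close>.
\<close>

definition FactModule ::
  "('a, 'b, 'm) module_scheme \<Rightarrow> 'b set \<Rightarrow> ('a, 'b set) module" where
  "FactModule M N =
     \<lparr>carrier = a_rcosets\<^bsub>M\<^esub> N, monoid.mult = undefined, monoid.one = undefined,
      ring.zero = N, ring.add = set_add M, module.smult = (\<lambda>a B. \<Union>u\<in>B. N +>\<^bsub>M\<^esub> (a \<odot>\<^bsub>M\<^esub> u))\<rparr>"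

text \<open>\<open>M / (x\<^sub>1, \<dots>, x\<^sub>n) M\<close>; only the values \<open>x 1, \<dots>, x n\<close> of \<open>x\<close> matter.\<close>

definition seq_quot ::
  "('a, 'r) ring_scheme \<Rightarrow> ('a, 'b, 'm) module_scheme \<Rightarrow> (nat \<Rightarrow> 'a) \<Rightarrow> nat \<Rightarrow> ('a, 'b set) module" where
  "seq_quot R M x n = FactModule M (ideal_times R M (Idl\<^bsub>R\<^esub> (x ` {1..n})))"

definition annihilator ::
  "('a, 'r) ring_scheme \<Rightarrow> ('a, 'b, 'm) module_scheme \<Rightarrow> 'a set" where
  "annihilator R M = {a \<in> carrier R. \<forall>u\<in>carrier M. a \<odot>\<^bsub>M\<^esub> u = \<zero>\<^bsub>M\<^esub>}"

definition module_dim ::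
  "('a, 'r) ring_scheme \<Rightarrow> ('a, 'b, 'm) module_scheme \<Rightarrow> enat" where
  "module_dim R M = krull_dim (R Quot (annihilator R M))"

definition module_length ::
  "('a, 'r) ring_scheme \<Rightarrow> ('a, 'b, 'm) module_scheme \<Rightarrow> enat" where
  "module_length R M = Sup {enat n | n. \<exists>N :: nat \<Rightarrow> 'b set.
     (\<forall>i\<le>n. submodule (N i) R M) \<and> (\<forall>i<n. N i \<subset> N (Suc i))}"

definition assoc_primes ::
  "('a, 'r) ring_scheme \<Rightarrow> ('a, 'b, 'm) module_scheme \<Rightarrow> 'a set set" where
  "assoc_primes R M = {P. primeideal P R \<and>
     (\<exists>u\<in>carrier M. P = {a \<in> carrier R. a \<odot>\<^bsub>M\<^esub> u = \<zero>\<^bsub>M\<^esub>})}"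

definition nonzerodivisor_on ::
  "('a, 'r) ring_scheme \<Rightarrow> ('a, 'b, 'm) module_scheme \<Rightarrow> 'a \<Rightarrow> bool" where
  "nonzerodivisor_on R M a \<longleftrightarrow>
     a \<in> carrier R \<and> (\<forall>u\<in>carrier M. a \<odot>\<^bsub>M\<^esub> u = \<zero>\<^bsub>M\<^esub> \<longrightarrow> u = \<zero>\<^bsub>M\<^esub>)"


section \<open>Depth and Cohen--Macaulay modules over a local ring\<close>

definition regular_sequence ::
  "('a, 'r) ring_scheme \<Rightarrow> ('a, 'b, 'm) module_scheme \<Rightarrow> (nat \<Rightarrow> 'a) \<Rightarrow> nat \<Rightarrow> bool" where
  "regular_sequence R M x n \<longleftrightarrow>
     (\<forall>i\<in>{1..n}. nonzerodivisor_on R (seq_quot R M x (i - 1)) (x i)) \<and>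
     carrier (seq_quot R M x n) \<noteq> {\<zero>\<^bsub>seq_quot R M x n\<^esub>}"

definition depth ::
  "('a, 'r) ring_scheme \<Rightarrow> ('a, 'b, 'm) module_scheme \<Rightarrow> enat" where
  "depth R M = Sup {enat n | n. \<exists>x. x ` {1..n} \<subseteq> max_ideal R \<and> regular_sequence R M x n}"

definition cohen_macaulay ::
  "('a, 'r) ring_scheme \<Rightarrow> ('a, 'b, 'm) module_scheme \<Rightarrow> bool" where
  "cohen_macaulay R M \<longleftrightarrow> depth R M = module_dim R M"


section \<open>Reducing systems of parameters\<close>

definition system_of_parameters ::
  "('a, 'r) ring_scheme \<Rightarrow> ('a, 'b, 'm) module_scheme \<Rightarrow> (nat \<Rightarrow> 'a) \<Rightarrow> nat \<Rightarrow> bool" where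
  "system_of_parameters R M x d \<longleftrightarrow>
     module_dim R M = enat d \<and> x ` {1..d} \<subseteq> max_ideal R \<and>
     module_length R (seq_quot R M x d) \<noteq> \<infinity>"

definition reducing_system_of_parameters ::
  "('a, 'r) ring_scheme \<Rightarrow> ('a, 'b, 'm) module_scheme \<Rightarrow> (nat \<Rightarrow> 'a) \<Rightarrow> nat \<Rightarrow> bool" where
  "reducing_system_of_parameters R M x d \<longleftrightarrow>
     system_of_parameters R M x d \<and>
     (\<forall>i\<in>{1..d - 1}. \<forall>P\<in>assoc_primes R (seq_quot R M x (i - 1)).
        krull_dim (R Quot P) = enat (d - i) \<longrightarrow> x i \<notin> P)"

end

theory Submission
  imports Defs
begin

text \<open>
  Quotients \<open>M / N\<close> are handled through the submodule \<open>N\<close> of \<open>M\<close>, and localisation at a prime \<open>P\<close>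
  through \<open>P\<close>-saturated submodules.

  The existence of a regular sequence of length \<open>n\<close> on \<open>M / N\<close> forces a chain of primes of length \<open>n\<close>
  above every associated prime of \<open>M / N\<close>, and Krull's height theorem bounds the chains above a prime
  containing \<open>annihilator R M\<close> and \<open>y\<^sub>1, \<dots>, y\<^sub>i\<close> by \<open>d - i\<close>. Hence for Cohen--Macaulay \<open>M\<close> no \<open>y\<^sub>i\<close>
  lies in an associated prime of \<open>M / (y\<^sub>1, \<dots>, y\<^sub>i\<^sub>-\<^sub>1) M\<close>; here one needs that depth drops by at most one
  modulo any regular element.

  Conversely, one shows by descending induction on \<open>i\<close> that \<open>x = y\<^sub>i\<close> is regular on
  \<open>M' = M / (y\<^sub>1, \<dots>, y\<^sub>i\<^sub>-\<^sub>1) M\<close>. An associated prime of \<open>M'\<close> containing \<open>x\<close> has coheight at most \<open>d - i\<close>,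
  and not \<open>d - i\<close> by the reducing condition, whereas every associated prime of \<open>M' / x M'\<close> has coheight
  at least \<open>d - i\<close>. So the \<open>x\<close>-power torsion of \<open>M'\<close> maps to zero in \<open>M' / x M'\<close>, and vanishes by
  Nakayama's lemma.
\<close>

section \<open>Submodules, saturation and Nakayama's lemma\<close>

text \<open>The number d - i has two sources that meet. From above it counts the parameters left
  after y_i: the maximal ideal is the only prime that contains a given prime above the annihilator
  and y_1, ..., y_i together with the other d - i parameters. From below it is the length of a
  regular sequence on M / (y_1, ..., y_i) M, supplied by the induction. The reducing condition
  excludes exactly this meeting point, and it is silent at i = d, which is why y_d appears
  separately in the theorem.

  Depth is a supremum over arbitrary sequences, so a regular sequence of length d says nothing
  directly about y. An exchange argument bridges this: in depth at least two, regular elements x and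
  y admit a z that is regular modulo x and modulo y, and through z a regular sequence starting with
  x is rebuilt to start with y.

  Saturated submodules are the submodules of a localisation seen inside M, so the maximum condition
  on M itself serves every localisation at once.\<close>

lemma (in ideal) diff_closed: "a \<in> I \<Longrightarrow> b \<in> I \<Longrightarrow> a \<ominus> b \<in> I"
  by (simp add: minus_eq)

lemma (in ideal) diff_cancel:
  assumes "a \<in> carrier R" "b \<in> I" "a \<ominus> b \<in> I" shows "a \<in> I"
proof -
  have "a = (a \<ominus> b) \<oplus> b"
    using assms(1) Icarr[OF assms(2)] by (simp add: minus_eq a_assoc l_neg)
  moreover have "(a \<ominus> b) \<oplus> b \<in> I" using assms by (simp add: a_closed)
  ultimately show ?thesis by simp
qed

lemma (in primeideal) one_notin: "\<one> \<notin> I"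
  using I_notcarr one_imp_carrier by blast

lemma (in primeideal) mult_notin:
  "a \<in> carrier R - I \<Longrightarrow> b \<in> carrier R - I \<Longrightarrow> a \<otimes> b \<in> carrier R - I"
  using I_prime by auto

lemma (in noetherian_ring) ex_maximal_ideal:
  assumes "C \<noteq> {}" "\<And>I. I \<in> C \<Longrightarrow> ideal I R"
  shows "\<exists>I\<in>C. \<forall>J\<in>C. I \<subseteq> J \<longrightarrow> J = I"
proof (rule subset_Zorn)
  fix D assume D: "subset.chain C D"
  show "\<exists>U\<in>C. \<forall>X\<in>D. X \<subseteq> U"
  proof (cases "D = {}")
    case True then show ?thesis using assms(1) by auto
  next
    case False
    have "subset.chain {I. ideal I R} D"
      using D assms(2) unfolding subset.chain_def by auto
    then have "\<Union>D \<in> D" using ideal_chain_is_trivial False by blast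
    moreover have "D \<subseteq> C" using D unfolding subset.chain_def by auto
    ultimately show ?thesis by auto
  qed
qed

context module
begin

lemma diff_smult:
  assumes "a \<in> carrier R" "b \<in> carrier R" "u \<in> carrier M"
  shows "(a \<ominus> b) \<odot>\<^bsub>M\<^esub> u = a \<odot>\<^bsub>M\<^esub> u \<ominus>\<^bsub>M\<^esub> b \<odot>\<^bsub>M\<^esub> u"
  using assms by (simp add: R.minus_eq M.minus_eq smult_l_distr smult_l_minus)

lemma smult_diff:
  assumes "a \<in> carrier R" "u \<in> carrier M" "v \<in> carrier M"
  shows "a \<odot>\<^bsub>M\<^esub> (u \<ominus>\<^bsub>M\<^esub> v) = a \<odot>\<^bsub>M\<^esub> u \<ominus>\<^bsub>M\<^esub> a \<odot>\<^bsub>M\<^esub> v"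
  using assms by (simp add: M.minus_eq smult_r_distr smult_r_minus)

lemma smult_left_commute:
  assumes "a \<in> carrier R" "b \<in> carrier R" "u \<in> carrier M"
  shows "a \<odot>\<^bsub>M\<^esub> (b \<odot>\<^bsub>M\<^esub> u) = b \<odot>\<^bsub>M\<^esub> (a \<odot>\<^bsub>M\<^esub> u)"
  using assms by (metis smult_assoc1 R.m_comm)

lemma add_diff_cancel:
  assumes "u \<in> carrier M" "v \<in> carrier M"
  shows "(u \<oplus>\<^bsub>M\<^esub> v) \<ominus>\<^bsub>M\<^esub> v = u" "(u \<oplus>\<^bsub>M\<^esub> v) \<ominus>\<^bsub>M\<^esub> u = v"
    "v \<oplus>\<^bsub>M\<^esub> (u \<ominus>\<^bsub>M\<^esub> v) = u" "(u \<ominus>\<^bsub>M\<^esub> v) \<oplus>\<^bsub>M\<^esub> v = u"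
proof -
  have 1: "(u \<oplus>\<^bsub>M\<^esub> v) \<ominus>\<^bsub>M\<^esub> v = u" if "u \<in> carrier M" "v \<in> carrier M" for u v
    using that by (simp add: M.minus_eq M.a_assoc M.r_neg)
  show "(u \<oplus>\<^bsub>M\<^esub> v) \<ominus>\<^bsub>M\<^esub> v = u" using 1 assms .
  show "(u \<oplus>\<^bsub>M\<^esub> v) \<ominus>\<^bsub>M\<^esub> u = v" using 1[of v u] assms by (simp add: M.a_comm)
  show "(u \<ominus>\<^bsub>M\<^esub> v) \<oplus>\<^bsub>M\<^esub> v = u"
    using assms by (simp add: M.minus_eq M.a_assoc M.l_neg)
  then show "v \<oplus>\<^bsub>M\<^esub> (u \<ominus>\<^bsub>M\<^esub> v) = u"
    using assms by (simp add: M.a_comm)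
qed

lemma submodule_carrier: "submodule N R M \<Longrightarrow> u \<in> N \<Longrightarrow> u \<in> carrier M"
  using submoduleE(1) by blast

lemma submodule_zero: assumes "submodule N R M" shows "\<zero>\<^bsub>M\<^esub> \<in> N"
proof -
  obtain u where "u \<in> N" using submoduleE(2)[OF assms] by auto
  then have "\<zero> \<odot>\<^bsub>M\<^esub> u \<in> N" using submoduleE(4)[OF assms] by simp
  then show ?thesis using \<open>u \<in> N\<close> submodule_carrier[OF assms] by simp
qed

lemma submodule_diff:
  "submodule N R M \<Longrightarrow> u \<in> N \<Longrightarrow> v \<in> N \<Longrightarrow> u \<ominus>\<^bsub>M\<^esub> v \<in> N"
  by (simp add: M.minus_eq submoduleE(3,5))

lemma submoduleI':
  assumes "H \<subseteq> carrier M" "\<zero>\<^bsub>M\<^esub> \<in> H"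
    and "\<And>a b. \<lbrakk>a \<in> H; b \<in> H\<rbrakk> \<Longrightarrow> a \<oplus>\<^bsub>M\<^esub> b \<in> H"
    and "\<And>a u. \<lbrakk>a \<in> carrier R; u \<in> H\<rbrakk> \<Longrightarrow> a \<odot>\<^bsub>M\<^esub> u \<in> H"
  shows "submodule H R M"
proof (rule submoduleI)
  fix a assume "a \<in> H"
  then have "(\<ominus> \<one>) \<odot>\<^bsub>M\<^esub> a \<in> H" using assms by simp
  then show "\<ominus>\<^bsub>M\<^esub> a \<in> H" using \<open>a \<in> H\<close> assms(1) by (simp add: smult_l_minus subset_iff)
qed (use assms in auto)

lemma submodule_singleton_zero: "submodule {\<zero>\<^bsub>M\<^esub>} R M"
  by (rule submoduleI') auto

lemma mem_set_add_iff: "w \<in> N <+>\<^bsub>M\<^esub> L \<longleftrightarrow> (\<exists>n\<in>N. \<exists>l\<in>L. w = n \<oplus>\<^bsub>M\<^esub> l)"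
  by (auto simp: set_add_defs)

lemma submodule_set_add:
  assumes N: "submodule N R M" and L: "submodule L R M"
  shows "submodule (N <+>\<^bsub>M\<^esub> L) R M"
proof (rule submoduleI')
  show "N <+>\<^bsub>M\<^esub> L \<subseteq> carrier M"
    using submoduleE(1)[OF N] submoduleE(1)[OF L] by (auto simp: mem_set_add_iff subset_iff)
  show "\<zero>\<^bsub>M\<^esub> \<in> N <+>\<^bsub>M\<^esub> L"
    unfolding mem_set_add_iff using submodule_zero[OF N] submodule_zero[OF L] by force
next
  fix a b assume "a \<in> N <+>\<^bsub>M\<^esub> L" "b \<in> N <+>\<^bsub>M\<^esub> L"
  then obtain n l n' l' where *: "n \<in> N" "l \<in> L" "n' \<in> N" "l' \<in> L"
    "a = n \<oplus>\<^bsub>M\<^esub> l" "b = n' \<oplus>\<^bsub>M\<^esub> l'" unfolding mem_set_add_iff by blast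
  then have "a \<oplus>\<^bsub>M\<^esub> b = (n \<oplus>\<^bsub>M\<^esub> n') \<oplus>\<^bsub>M\<^esub> (l \<oplus>\<^bsub>M\<^esub> l')"
    using submodule_carrier[OF N] submodule_carrier[OF L] by (simp add: M.a_ac)
  then show "a \<oplus>\<^bsub>M\<^esub> b \<in> N <+>\<^bsub>M\<^esub> L"
    unfolding mem_set_add_iff using * submoduleE(5)[OF N] submoduleE(5)[OF L] by blast
next
  fix a u assume a: "a \<in> carrier R" and "u \<in> N <+>\<^bsub>M\<^esub> L"
  then obtain n l where *: "n \<in> N" "l \<in> L" "u = n \<oplus>\<^bsub>M\<^esub> l"
    unfolding mem_set_add_iff by blast
  then have "a \<odot>\<^bsub>M\<^esub> u = a \<odot>\<^bsub>M\<^esub> n \<oplus>\<^bsub>M\<^esub> a \<odot>\<^bsub>M\<^esub> l"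
    using a submodule_carrier[OF N] submodule_carrier[OF L] by (simp add: smult_r_distr)
  then show "a \<odot>\<^bsub>M\<^esub> u \<in> N <+>\<^bsub>M\<^esub> L"
    unfolding mem_set_add_iff using * a submoduleE(4)[OF N] submoduleE(4)[OF L] by blast
qed

lemma set_add_upper:
  assumes "submodule N R M" "submodule L R M"
  shows "N \<subseteq> N <+>\<^bsub>M\<^esub> L" "L \<subseteq> N <+>\<^bsub>M\<^esub> L"
proof -
  have "n = n \<oplus>\<^bsub>M\<^esub> \<zero>\<^bsub>M\<^esub>" "n = \<zero>\<^bsub>M\<^esub> \<oplus>\<^bsub>M\<^esub> n" if "n \<in> carrier M" for n
    using that by simp_all
  then show "N \<subseteq> N <+>\<^bsub>M\<^esub> L" "L \<subseteq> N <+>\<^bsub>M\<^esub> L"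
    unfolding mem_set_add_iff subset_iff
    using submodule_zero[OF assms(1)] submodule_zero[OF assms(2)]
      submodule_carrier[OF assms(1)] submodule_carrier[OF assms(2)] by blast+
qed

lemma set_add_least:
  "submodule K R M \<Longrightarrow> N \<subseteq> K \<Longrightarrow> L \<subseteq> K \<Longrightarrow> N <+>\<^bsub>M\<^esub> L \<subseteq> K"
  using submoduleE(5)[of K] by (auto simp: mem_set_add_iff subset_iff)

definition multiples :: "'a \<Rightarrow> 'c set \<Rightarrow> 'c set" where
  "multiples x N = (\<lambda>u. x \<odot>\<^bsub>M\<^esub> u) ` N"

definition cyclic :: "'c \<Rightarrow> 'c set" where
  "cyclic b = (\<lambda>r. r \<odot>\<^bsub>M\<^esub> b) ` carrier R"

lemma mem_add_cyclic_iff: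
  "w \<in> N <+>\<^bsub>M\<^esub> cyclic b \<longleftrightarrow> (\<exists>n\<in>N. \<exists>r\<in>carrier R. w = n \<oplus>\<^bsub>M\<^esub> r \<odot>\<^bsub>M\<^esub> b)"
  by (auto simp: mem_set_add_iff cyclic_def)

lemma mem_add_multiples_iff:
  "w \<in> N <+>\<^bsub>M\<^esub> multiples x L \<longleftrightarrow> (\<exists>n\<in>N. \<exists>u\<in>L. w = n \<oplus>\<^bsub>M\<^esub> x \<odot>\<^bsub>M\<^esub> u)"
  by (auto simp: mem_set_add_iff multiples_def)

lemma submodule_multiples:
  assumes "submodule N R M" "x \<in> carrier R" shows "submodule (multiples x N) R M"
proof (rule submoduleI')
  show "multiples x N \<subseteq> carrier M"
    using assms submodule_carrier by (auto simp: multiples_def)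
  show "\<zero>\<^bsub>M\<^esub> \<in> multiples x N"
    using submodule_zero[OF assms(1)] assms(2) unfolding multiples_def by (force simp: image_iff)
next
  fix a b assume "a \<in> multiples x N" "b \<in> multiples x N"
  then obtain u v where *: "u \<in> N" "v \<in> N" "a = x \<odot>\<^bsub>M\<^esub> u" "b = x \<odot>\<^bsub>M\<^esub> v"
    unfolding multiples_def by blast
  then have "a \<oplus>\<^bsub>M\<^esub> b = x \<odot>\<^bsub>M\<^esub> (u \<oplus>\<^bsub>M\<^esub> v)"
    using assms submodule_carrier by (simp add: smult_r_distr)
  then show "a \<oplus>\<^bsub>M\<^esub> b \<in> multiples x N"
    unfolding multiples_def using * submoduleE(5)[OF assms(1)] by blast
next
  fix a u assume a: "a \<in> carrier R" "u \<in> multiples x N"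
  then obtain v where *: "v \<in> N" "u = x \<odot>\<^bsub>M\<^esub> v" unfolding multiples_def by blast
  then have "a \<odot>\<^bsub>M\<^esub> u = x \<odot>\<^bsub>M\<^esub> (a \<odot>\<^bsub>M\<^esub> v)"
    using assms a submodule_carrier smult_left_commute by blast
  then show "a \<odot>\<^bsub>M\<^esub> u \<in> multiples x N"
    unfolding multiples_def using * a submoduleE(4)[OF assms(1)] by blast
qed

lemma submodule_cyclic:
  assumes "b \<in> carrier M" shows "submodule (cyclic b) R M"
proof (rule submoduleI')
  show "cyclic b \<subseteq> carrier M" using assms by (auto simp: cyclic_def)
  show "\<zero>\<^bsub>M\<^esub> \<in> cyclic b" using assms unfolding cyclic_def by (force simp: image_iff)
next
  fix u v assume "u \<in> cyclic b" "v \<in> cyclic b"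
  then obtain r s where *: "r \<in> carrier R" "s \<in> carrier R" "u = r \<odot>\<^bsub>M\<^esub> b" "v = s \<odot>\<^bsub>M\<^esub> b"
    unfolding cyclic_def by blast
  then have "u \<oplus>\<^bsub>M\<^esub> v = (r \<oplus> s) \<odot>\<^bsub>M\<^esub> b" using assms by (simp add: smult_l_distr)
  then show "u \<oplus>\<^bsub>M\<^esub> v \<in> cyclic b" unfolding cyclic_def using * by blast
next
  fix a u assume a: "a \<in> carrier R" "u \<in> cyclic b"
  then obtain r where *: "r \<in> carrier R" "u = r \<odot>\<^bsub>M\<^esub> b" unfolding cyclic_def by blast
  then have "a \<odot>\<^bsub>M\<^esub> u = (a \<otimes> r) \<odot>\<^bsub>M\<^esub> b" using assms a by (simp add: smult_assoc1)
  then show "a \<odot>\<^bsub>M\<^esub> u \<in> cyclic b" unfolding cyclic_def using * a by blast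
qed

lemma cyclic_self: "b \<in> carrier M \<Longrightarrow> b \<in> cyclic b"
  unfolding cyclic_def by (force simp: image_iff)

lemma cyclic_least: "submodule K R M \<Longrightarrow> b \<in> K \<Longrightarrow> cyclic b \<subseteq> K"
  by (auto simp: cyclic_def intro: submoduleE(4))

text \<open>The annihilator of the class of \<open>u\<close> in M / \<open>N\<close>. The associated
  primes of M / \<open>N\<close> are the prime ideals of this form.\<close>

definition colon :: "'c set \<Rightarrow> 'c \<Rightarrow> 'a set" where
  "colon N u = {a \<in> carrier R. a \<odot>\<^bsub>M\<^esub> u \<in> N}"

lemma ideal_colon:
  assumes N: "submodule N R M" and u: "u \<in> carrier M" shows "ideal (colon N u) R"
proof (rule idealI)
  show "ring R" by (rule R.ring_axioms)
  show "subgroup (colon N u) (add_monoid R)"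
  proof (rule group.subgroupI)
    show "group (add_monoid R)" by (rule R.a_group)
    show "colon N u \<subseteq> carrier (add_monoid R)" by (auto simp: colon_def)
    show "colon N u \<noteq> {}"
      using submodule_zero[OF N] u by (auto simp: colon_def intro: exI[of _ \<zero>])
  next
    fix a assume a: "a \<in> colon N u"
    then have "\<ominus> a \<in> colon N u"
      using N u by (simp add: colon_def smult_l_minus submoduleE(3))
    then show "inv\<^bsub>add_monoid R\<^esub> a \<in> colon N u" by (simp add: a_inv_def)
  next
    fix a b assume "a \<in> colon N u" "b \<in> colon N u"
    then show "a \<otimes>\<^bsub>add_monoid R\<^esub> b \<in> colon N u"
      using N u by (simp add: colon_def smult_l_distr submoduleE(5))
  qed
next
  fix a x assume *: "a \<in> colon N u" "x \<in> carrier R"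
  then show "x \<otimes> a \<in> colon N u"
    using N u by (simp add: colon_def smult_assoc1 submoduleE(4))
  then show "a \<otimes> x \<in> colon N u" using * by (simp add: colon_def R.m_comm)
qed

lemma one_in_colon_iff: "u \<in> carrier M \<Longrightarrow> \<one> \<in> colon N u \<longleftrightarrow> u \<in> N"
  by (simp add: colon_def)

text \<open>Saturated submodules are the preimages in M of submodules of the localisation at
  \<open>P\<close>. An inclusion into a saturated submodule therefore expresses an inclusion after
  localising.\<close>

definition saturated :: "'a set \<Rightarrow> 'c set \<Rightarrow> bool" where
  "saturated P N \<longleftrightarrow> (\<forall>s\<in>carrier R - P. \<forall>u\<in>carrier M. s \<odot>\<^bsub>M\<^esub> u \<in> N \<longrightarrow> u \<in> N)"

definition saturation :: "'a set \<Rightarrow> 'c set \<Rightarrow> 'c set" where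
  "saturation P N = {u \<in> carrier M. \<exists>s\<in>carrier R - P. s \<odot>\<^bsub>M\<^esub> u \<in> N}"

lemma submodule_saturation:
  assumes P: "primeideal P R" and N: "submodule N R M"
  shows "submodule (saturation P N) R M"
proof (rule submoduleI')
  interpret P: primeideal P R by (rule P)
  show "saturation P N \<subseteq> carrier M" by (auto simp: saturation_def)
  show "\<zero>\<^bsub>M\<^esub> \<in> saturation P N"
    using submodule_zero[OF N] P.one_notin by (auto simp: saturation_def)
next
  interpret P: primeideal P R by (rule P)
  fix a b assume ab: "a \<in> saturation P N" "b \<in> saturation P N"
  then obtain s t where st: "s \<in> carrier R - P" "t \<in> carrier R - P"
    "s \<odot>\<^bsub>M\<^esub> a \<in> N" "t \<odot>\<^bsub>M\<^esub> b \<in> N" and c: "a \<in> carrier M" "b \<in> carrier M"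
    unfolding saturation_def by blast
  have "(s \<otimes> t) \<odot>\<^bsub>M\<^esub> (a \<oplus>\<^bsub>M\<^esub> b) = t \<odot>\<^bsub>M\<^esub> (s \<odot>\<^bsub>M\<^esub> a) \<oplus>\<^bsub>M\<^esub> s \<odot>\<^bsub>M\<^esub> (t \<odot>\<^bsub>M\<^esub> b)"
    using st c smult_left_commute by (simp add: smult_r_distr smult_assoc1)
  then have "(s \<otimes> t) \<odot>\<^bsub>M\<^esub> (a \<oplus>\<^bsub>M\<^esub> b) \<in> N"
    using st N submoduleE(4,5) by simp
  then show "a \<oplus>\<^bsub>M\<^esub> b \<in> saturation P N"
    using c P.mult_notin[OF st(1,2)] by (auto simp: saturation_def)
next
  fix a u assume a: "a \<in> carrier R" "u \<in> saturation P N"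
  then obtain s where s: "s \<in> carrier R - P" "s \<odot>\<^bsub>M\<^esub> u \<in> N" "u \<in> carrier M"
    unfolding saturation_def by blast
  then have "s \<odot>\<^bsub>M\<^esub> (a \<odot>\<^bsub>M\<^esub> u) \<in> N"
    using a N smult_left_commute[of s a u] submoduleE(4) by simp
  then show "a \<odot>\<^bsub>M\<^esub> u \<in> saturation P N" using s a by (auto simp: saturation_def)
qed

lemma saturated_saturation:
  assumes P: "primeideal P R" shows "saturated P (saturation P N)"
  unfolding saturated_def
proof (intro ballI impI)
  interpret P: primeideal P R by (rule P)
  fix s u assume su: "s \<in> carrier R - P" "u \<in> carrier M" "s \<odot>\<^bsub>M\<^esub> u \<in> saturation P N"
  then obtain t where t: "t \<in> carrier R - P" "t \<odot>\<^bsub>M\<^esub> (s \<odot>\<^bsub>M\<^esub> u) \<in> N"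
    unfolding saturation_def by blast
  then have "(t \<otimes> s) \<odot>\<^bsub>M\<^esub> u \<in> N" using su by (simp add: smult_assoc1)
  then show "u \<in> saturation P N"
    using su P.mult_notin[OF t(1) su(1)] by (auto simp: saturation_def)
qed

lemma saturation_upper:
  assumes P: "primeideal P R" and N: "N \<subseteq> carrier M" shows "N \<subseteq> saturation P N"
proof
  interpret P: primeideal P R by (rule P)
  fix u assume "u \<in> N"
  then show "u \<in> saturation P N"
    using N P.one_notin by (auto simp: saturation_def intro!: bexI[of _ \<one>])
qed

lemma saturation_least: "saturated P K \<Longrightarrow> N \<subseteq> K \<Longrightarrow> saturation P N \<subseteq> K"
  by (auto simp: saturated_def saturation_def)

end

text \<open>The maximum condition is the assumption, so that one set of lemmas covers both finitely
  generated modules and the ring as a module over itself.\<close>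

locale noetherian_module = module +
  assumes ex_maximal_submodule:
    "C \<noteq> {} \<Longrightarrow> (\<And>N. N \<in> C \<Longrightarrow> submodule N R M) \<Longrightarrow> \<exists>N\<in>C. \<forall>L\<in>C. N \<subseteq> L \<longrightarrow> L = N"
begin

text \<open>The hypothesis on \<open>L\<close> says that, locally at \<open>P\<close>, the set
  \<open>I\<close> is contained in \<open>K\<close> plus \<open>P\<close> times \<open>I\<close>. In
  place of generators and determinants, the argument takes \<open>L\<close> maximal among the
  saturated submodules containing \<open>K\<close> but not \<open>I\<close>, and shows that it
  contains \<open>P\<close> times \<open>I\<close>.\<close>

lemma nakayama:
  assumes P: "primeideal P R"
    and K: "submodule K R M" "saturated P K"
    and I: "I \<subseteq> carrier M"
    and hyp: "\<And>L. \<lbrakk>submodule L R M; saturated P L; K \<subseteq> L; \<And>p u. p \<in> P \<Longrightarrow> u \<in> I \<Longrightarrow> p \<odot>\<^bsub>M\<^esub> u \<in> L\<rbrakk>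
      \<Longrightarrow> I \<subseteq> L"
  shows "I \<subseteq> K"
proof (rule ccontr)
  interpret P: primeideal P R by (rule P)
  assume notIK: "\<not> I \<subseteq> K"
  define C where "C = {L. submodule L R M \<and> saturated P L \<and> K \<subseteq> L \<and> \<not> I \<subseteq> L}"
  have "C \<noteq> {}" using K notIK unfolding C_def by blast
  moreover have "submodule L R M" if "L \<in> C" for L using that unfolding C_def by simp
  ultimately obtain L where L: "L \<in> C" and max: "\<And>L'. L' \<in> C \<Longrightarrow> L \<subseteq> L' \<Longrightarrow> L' = L"
    using ex_maximal_submodule[of C] by metis
  from L have Ls: "submodule L R M" "saturated P L" "K \<subseteq> L" "\<not> I \<subseteq> L" unfolding C_def by auto
  have "p \<odot>\<^bsub>M\<^esub> b \<in> L" if p: "p \<in> P" and b: "b \<in> I" for p b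
  proof (rule ccontr)
    assume pb: "p \<odot>\<^bsub>M\<^esub> b \<notin> L"
    have pc: "p \<in> carrier R" and bc: "b \<in> carrier M" using p b I P.Icarr by auto
    let ?A = "L <+>\<^bsub>M\<^esub> cyclic (p \<odot>\<^bsub>M\<^esub> b)"
    have cy: "submodule (cyclic (p \<odot>\<^bsub>M\<^esub> b)) R M" using pc bc submodule_cyclic by simp
    have A: "submodule ?A R M" by (rule submodule_set_add[OF Ls(1) cy])
    have AL: "?A \<subseteq> saturation P ?A" using saturation_upper[OF P] submoduleE(1)[OF A] by blast
    have "L \<subseteq> ?A" "p \<odot>\<^bsub>M\<^esub> b \<in> ?A"
      using set_add_upper[OF Ls(1) cy] cyclic_self[of "p \<odot>\<^bsub>M\<^esub> b"] pc bc by auto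
    then have "saturation P ?A \<notin> C" using max[of "saturation P ?A"] AL pb by blast
    then have "I \<subseteq> saturation P ?A"
      using submodule_saturation[OF P A] saturated_saturation[OF P, of ?A] AL \<open>L \<subseteq> ?A\<close> Ls(3)
      unfolding C_def by blast
    then obtain s where s: "s \<in> carrier R - P" "s \<odot>\<^bsub>M\<^esub> b \<in> ?A"
      using b unfolding saturation_def by blast
    then obtain l r where lr: "l \<in> L" "r \<in> carrier R" "s \<odot>\<^bsub>M\<^esub> b = l \<oplus>\<^bsub>M\<^esub> r \<odot>\<^bsub>M\<^esub> (p \<odot>\<^bsub>M\<^esub> b)"
      unfolding mem_add_cyclic_iff by blast
    have lc: "l \<in> carrier M" using lr Ls submodule_carrier by blast
    \<comment> \<open>The scalar \<open>s \<ominus> r \<otimes> p\<close> lies outside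
      \<open>P\<close>, hence is a unit locally; it plays the part of 1 - p in the usual
      argument.\<close>
    have "(s \<ominus> r \<otimes> p) \<odot>\<^bsub>M\<^esub> b = l"
      using s lr pc bc lc by (simp add: diff_smult smult_assoc1 add_diff_cancel)
    moreover have "s \<ominus> r \<otimes> p \<notin> P"
      using P.diff_cancel[of s "r \<otimes> p"] s p lr P.I_l_closed by auto
    ultimately have "b \<in> L"
      using Ls(2) lr s pc bc unfolding saturated_def by (metis DiffI DiffD1 R.m_closed R.minus_closed)
    then show False using pb submoduleE(4)[OF Ls(1)] pc by blast
  qed
  then show False using hyp[OF Ls(1-3)] Ls(4) by blast
qed

end

section \<open>Associated primes\<close>

text \<open>Induction on the generators needs a maximum condition relative to a submodule
  \<open>W\<close>: \<open>acc W\<close> asks for a member of the family whose trace on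
  \<open>W\<close> does not grow in larger members. Once \<open>W\<close> is all of M, this is the
  maximum condition itself.\<close>

lemma noetherian_module_if_fin_gen:
  assumes R: "noetherian_ring R" and M: "module R M" and fg: "fin_gen_module R M"
  shows "noetherian_module R M"
proof -
  interpret R: noetherian_ring R by (rule R)
  interpret module R M by (rule M)
  define acc where "acc W \<longleftrightarrow> (\<forall>C. C \<noteq> {} \<longrightarrow> (\<forall>A\<in>C. submodule A R M) \<longrightarrow>
    (\<exists>A\<in>C. \<forall>B\<in>C. A \<subseteq> B \<longrightarrow> B \<inter> W \<subseteq> A))" for W
  have ex: "\<exists>W. submodule W R M \<and> S \<subseteq> W \<and> acc W" if "finite S" "S \<subseteq> carrier M" for S
    using that
  proof (induction S)
    case empty
    have "acc {\<zero>\<^bsub>M\<^esub>}" unfolding acc_def using submodule_zero by auto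
    then show ?case using submodule_singleton_zero by blast
  next
    case (insert s S)
    then obtain W where W: "submodule W R M" "S \<subseteq> W" "acc W" by auto
    have s: "s \<in> carrier M" using insert by simp
    let ?W = "W <+>\<^bsub>M\<^esub> cyclic s"
    have "acc ?W"
      unfolding acc_def
    proof (intro allI impI)
      fix C :: "'c set set" assume C: "C \<noteq> {}" "\<forall>A\<in>C. submodule A R M"
      then obtain A where A: "A \<in> C" "\<And>B. B \<in> C \<Longrightarrow> A \<subseteq> B \<Longrightarrow> B \<inter> W \<subseteq> A"
        using W(3) unfolding acc_def by metis
      \<comment> \<open>A choice in two stages: above an \<open>A\<close> with maximal trace on
        \<open>W\<close>, a \<open>B\<close> with the largest ideal of coefficients of
        \<open>s\<close> modulo \<open>W\<close>. An element of a larger \<open>B'\<close> then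
        differs from an element of \<open>B\<close> by something in \<open>W\<close>, where nothing
        grows any more.\<close>
      let ?col = "\<lambda>B. colon (B <+>\<^bsub>M\<^esub> W) s"
      define D where "D = ?col ` {B \<in> C. A \<subseteq> B}"
      have "D \<noteq> {}" using A unfolding D_def by auto
      moreover have "ideal J R" if "J \<in> D" for J
        using that C(2) W(1) s ideal_colon submodule_set_add unfolding D_def by auto
      ultimately obtain J where J: "J \<in> D" "\<And>I. I \<in> D \<Longrightarrow> J \<subseteq> I \<Longrightarrow> I = J"
        using R.ex_maximal_ideal[of D] by metis
      then obtain B where B: "B \<in> C" "A \<subseteq> B" "J = ?col B" unfolding D_def by blast
      have "B' \<inter> ?W \<subseteq> B" if B': "B' \<in> C" "B \<subseteq> B'" for B'
      proof
        fix b assume b: "b \<in> B' \<inter> ?W"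
        have Bs: "submodule B R M" "submodule B' R M" using C B B' by auto
        have "?col B \<subseteq> ?col B'"
          using B' unfolding colon_def mem_set_add_iff by blast
        then have eq: "?col B' = ?col B" using J(2)[of "?col B'"] B B' unfolding D_def by auto
        obtain w r where wr: "w \<in> W" "r \<in> carrier R" "b = w \<oplus>\<^bsub>M\<^esub> r \<odot>\<^bsub>M\<^esub> s"
          using b mem_add_cyclic_iff[of b W s] by blast
        have wc: "w \<in> carrier M" and bc: "b \<in> carrier M"
          using wr W b Bs submodule_carrier by blast+
        have "r \<odot>\<^bsub>M\<^esub> s = b \<oplus>\<^bsub>M\<^esub> (\<ominus>\<^bsub>M\<^esub> w)"
          using wr wc s by (simp add: add_diff_cancel flip: M.minus_eq)
        then have r: "r \<in> ?col B'"
          unfolding colon_def mem_set_add_iff using wr b submoduleE(3)[OF W(1)] by blast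
        obtain a w' where aw: "a \<in> B" "w' \<in> W" "r \<odot>\<^bsub>M\<^esub> s = a \<oplus>\<^bsub>M\<^esub> w'"
          using r[unfolded eq] unfolding colon_def mem_set_add_iff by blast
        have ac: "a \<in> carrier M" "w' \<in> carrier M" using aw Bs W submodule_carrier by blast+
        have "b = (w \<oplus>\<^bsub>M\<^esub> w') \<oplus>\<^bsub>M\<^esub> a" using wr aw ac wc by (simp add: M.a_ac)
        then have ba: "b \<ominus>\<^bsub>M\<^esub> a = w \<oplus>\<^bsub>M\<^esub> w'" using ac wc add_diff_cancel by simp
        have "b \<ominus>\<^bsub>M\<^esub> a \<in> B'" using submodule_diff[OF Bs(2)] b aw B' by blast
        moreover have "b \<ominus>\<^bsub>M\<^esub> a \<in> W" using ba submoduleE(5)[OF W(1)] wr aw by simp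
        ultimately have "b \<ominus>\<^bsub>M\<^esub> a \<in> B" using A(2)[of B'] B B' by blast
        then have "(b \<ominus>\<^bsub>M\<^esub> a) \<oplus>\<^bsub>M\<^esub> a \<in> B" using aw submoduleE(5)[OF Bs(1)] by blast
        then show "b \<in> B" using bc ac add_diff_cancel by simp
      qed
      then show "\<exists>A\<in>C. \<forall>B\<in>C. A \<subseteq> B \<longrightarrow> B \<inter> ?W \<subseteq> A" using B by blast
    qed
    moreover have "insert s S \<subseteq> ?W"
      using set_add_upper[OF W(1) submodule_cyclic[OF s]] cyclic_self[OF s] W(2) by blast
    ultimately show ?case using submodule_set_add[OF W(1) submodule_cyclic[OF s]] by blast
  qed
  obtain S where S: "finite S" "S \<subseteq> carrier M" "submodule_span R M S = carrier M"
    using fg unfolding fin_gen_module_def by blast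
  obtain W where W: "submodule W R M" "S \<subseteq> W" "acc W" using ex[OF S(1,2)] by blast
  have "carrier M \<subseteq> W" using W S(3) unfolding submodule_span_def by blast
  show ?thesis
  proof
    fix C :: "'c set set" assume C: "C \<noteq> {}" "\<And>N. N \<in> C \<Longrightarrow> submodule N R M"
    then obtain A where A: "A \<in> C" "\<And>B. B \<in> C \<Longrightarrow> A \<subseteq> B \<Longrightarrow> B \<inter> W \<subseteq> A"
      using W(3) unfolding acc_def by metis
    have "B = A" if "B \<in> C" "A \<subseteq> B" for B
      using A(2)[OF that] that C(2)[OF that(1)] submoduleE(1) \<open>carrier M \<subseteq> W\<close> by blast
    then show "\<exists>N\<in>C. \<forall>L\<in>C. N \<subseteq> L \<longrightarrow> L = N" using A(1) by blast
  qed
qed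

context module
begin

lemma add_mem_iff:
  assumes N: "submodule N R M" and "n \<in> N" "w \<in> carrier M"
  shows "n \<oplus>\<^bsub>M\<^esub> w \<in> N \<longleftrightarrow> w \<in> N"
proof
  assume "n \<oplus>\<^bsub>M\<^esub> w \<in> N"
  then have "(n \<oplus>\<^bsub>M\<^esub> w) \<ominus>\<^bsub>M\<^esub> n \<in> N" using submodule_diff N assms by blast
  then show "w \<in> N" using assms submodule_carrier[OF N] add_diff_cancel by simp
next
  assume "w \<in> N"
  then show "n \<oplus>\<^bsub>M\<^esub> w \<in> N" using assms(2) submoduleE(5)[OF N] by simp
qed

text \<open>The class of \<open>v\<close> generates a copy of R modulo a prime, a domain, so all its
  nonzero multiples have the same annihilator.\<close>

lemma colon_smult_prime:
  assumes N: "submodule N R M" and v: "v \<in> carrier M" and P: "primeideal (colon N v) R"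
    and r: "r \<in> carrier R" "r \<odot>\<^bsub>M\<^esub> v \<notin> N"
  shows "colon N (r \<odot>\<^bsub>M\<^esub> v) = colon N v"
proof -
  have I: "ideal (colon N v) R" using P by (rule primeideal.axioms)
  have "t \<in> colon N (r \<odot>\<^bsub>M\<^esub> v) \<longleftrightarrow> t \<in> colon N v" if t: "t \<in> carrier R" for t
  proof -
    have "t \<in> colon N (r \<odot>\<^bsub>M\<^esub> v) \<longleftrightarrow> t \<otimes> r \<in> colon N v"
      using t r v by (simp add: colon_def smult_assoc1)
    also have "\<dots> \<longleftrightarrow> t \<in> colon N v"
      
    proof
      assume "t \<otimes> r \<in> colon N v"
      moreover have "r \<notin> colon N v" using r by (simp add: colon_def)
      ultimately show "t \<in> colon N v" using primeideal.I_prime[OF P t r(1)] by blast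
    next
      assume "t \<in> colon N v"
      then show "t \<otimes> r \<in> colon N v" using ideal.I_r_closed[OF I] r by blast
    qed
    finally show ?thesis .
  qed
  then show ?thesis by (auto simp: colon_def)
qed

lemma colon_mono: "N \<subseteq> L \<Longrightarrow> colon N u \<subseteq> colon L u"
  by (auto simp: colon_def)

lemma colon_prime_notin: "u \<in> carrier M \<Longrightarrow> primeideal (colon N u) R \<Longrightarrow> u \<notin> N"
  using primeideal.one_notin one_in_colon_iff by blast

end

locale noetherian_ring_module = noetherian_module R M + noetherian_ring R
  for R (structure) and M (structure)
begin

text \<open>An ideal maximal among the annihilators of multiples of \<open>u\<close> that stay
  inside \<open>P\<close> is prime. The restriction to \<open>P\<close> localises the usual argument
  and yields an associated prime below the given one.\<close>

lemma ex_associated_prime: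
  assumes N: "submodule N R M" and u: "u \<in> carrier M"
    and P: "primeideal P R" "colon N u \<subseteq> P"
  obtains r where "r \<in> carrier R" "primeideal (colon N (r \<odot>\<^bsub>M\<^esub> u)) R" "colon N (r \<odot>\<^bsub>M\<^esub> u) \<subseteq> P"
proof -
  interpret P: primeideal P R by (rule P)
  define C where "C = {colon N (r \<odot>\<^bsub>M\<^esub> u) | r. r \<in> carrier R \<and> colon N (r \<odot>\<^bsub>M\<^esub> u) \<subseteq> P}"
  have "colon N (\<one> \<odot>\<^bsub>M\<^esub> u) \<in> C" using u P unfolding C_def by force
  then have "C \<noteq> {}" by blast
  moreover have "ideal I R" if "I \<in> C" for I
    using that u N ideal_colon unfolding C_def by auto
  ultimately obtain I where I: "I \<in> C" and max: "\<And>J. J \<in> C \<Longrightarrow> I \<subseteq> J \<Longrightarrow> J = I"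
    using ex_maximal_ideal[of C] by metis
  obtain r where r: "r \<in> carrier R" "I = colon N (r \<odot>\<^bsub>M\<^esub> u)" "I \<subseteq> P"
    using I unfolding C_def by blast
  define v where "v = r \<odot>\<^bsub>M\<^esub> u"
  have v: "v \<in> carrier M" "I = colon N v" using r u v_def by auto
  have maxv: "colon N (a \<odot>\<^bsub>M\<^esub> v) = I" if a: "a \<in> carrier R" "colon N (a \<odot>\<^bsub>M\<^esub> v) \<subseteq> P" for a
  proof (rule max)
    have "a \<odot>\<^bsub>M\<^esub> v = (a \<otimes> r) \<odot>\<^bsub>M\<^esub> u" using a r u by (simp add: v_def smult_assoc1)
    then show "colon N (a \<odot>\<^bsub>M\<^esub> v) \<in> C" 
      using a r unfolding C_def by (auto intro!: exI[of _ "a \<otimes> r"])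
    show "I \<subseteq> colon N (a \<odot>\<^bsub>M\<^esub> v)"
      using v a N smult_left_commute[OF _ a(1) v(1)] submoduleE(4)[OF N] by (auto simp: colon_def)
  qed
  have "primeideal I R"
  proof (rule primeidealI)
    show "ideal I R" using v N ideal_colon by simp
    show "cring R" by (rule R.is_cring)
    show "carrier R \<noteq> I" using r P.one_notin by blast
  next
    fix a b assume ab: "a \<in> carrier R" "b \<in> carrier R" "a \<otimes> b \<in> I"
    have abv: "b \<odot>\<^bsub>M\<^esub> (a \<odot>\<^bsub>M\<^esub> v) \<in> N"
      using ab v smult_left_commute[of a b v] by (simp add: colon_def smult_assoc1)
    show "a \<in> I \<or> b \<in> I"
    proof (cases "colon N (a \<odot>\<^bsub>M\<^esub> v) \<subseteq> P")
      case True
      then show ?thesis using maxv[OF ab(1)] abv ab by (auto simp: colon_def)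
    next
      case False
      then obtain s where s: "s \<in> carrier R" "s \<odot>\<^bsub>M\<^esub> (a \<odot>\<^bsub>M\<^esub> v) \<in> N" "s \<notin> P"
        by (auto simp: colon_def)
      \<comment> \<open>Passing from \<open>v\<close> to its multiple by \<open>s\<close> outside
        \<open>P\<close> keeps the annihilator inside \<open>P\<close>, so by maximality it does not
        change; but now \<open>a\<close> belongs to it.\<close>
      have "colon N (s \<odot>\<^bsub>M\<^esub> v) \<subseteq> P"
      proof
        fix t assume t: "t \<in> colon N (s \<odot>\<^bsub>M\<^esub> v)"
        then have "t \<otimes> s \<in> I" using s v by (simp add: colon_def smult_assoc1)
        then show "t \<in> P" using P.I_prime[of t s] r s t by (auto simp: colon_def)
      qed
      then have "colon N (s \<odot>\<^bsub>M\<^esub> v) = I" using maxv s by blast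
      moreover have "a \<in> colon N (s \<odot>\<^bsub>M\<^esub> v)"
        using ab s v smult_left_commute[of a s v] by (simp add: colon_def)
      ultimately show ?thesis by blast
    qed
  qed
  then show ?thesis using that r by blast
qed

text \<open>A maximal counterexample \<open>L\<close> is enlarged by an element \<open>u\<close>
  whose annihilator modulo \<open>L\<close> is prime. This removes at most that one prime from the
  associated primes, so the larger submodule would be a counterexample too.\<close>

lemma finite_associated_primes:
  assumes N: "submodule N R M"
  shows "finite {P. primeideal P R \<and> (\<exists>u\<in>carrier M. P = colon N u)}"
proof (rule ccontr)
  let ?Ass = "\<lambda>N. {P. primeideal P R \<and> (\<exists>u\<in>carrier M. P = colon N u)}"
  assume inf: "infinite (?Ass N)"
  define C where "C = {L. submodule L R M \<and> infinite (?Ass L)}"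
  have "C \<noteq> {}" using inf N unfolding C_def by blast
  moreover have "submodule L R M" if "L \<in> C" for L using that unfolding C_def by simp
  ultimately obtain L where L: "L \<in> C" and max: "\<And>L'. L' \<in> C \<Longrightarrow> L \<subseteq> L' \<Longrightarrow> L' = L"
    using ex_maximal_submodule[of C] by metis
  have Ls: "submodule L R M" "infinite (?Ass L)" using L unfolding C_def by auto
  then have "?Ass L \<noteq> {}" by (metis finite.emptyI)
  then obtain u where u: "u \<in> carrier M" "primeideal (colon L u) R" by blast
  have cy: "submodule (cyclic u) R M" using submodule_cyclic u by blast
  let ?L = "L <+>\<^bsub>M\<^esub> cyclic u"
  have "u \<notin> L" using colon_prime_notin u by blast
  moreover have "L \<subseteq> ?L" "u \<in> ?L" using set_add_upper[OF Ls(1) cy] cyclic_self[OF u(1)] by auto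
  moreover have L': "submodule ?L R M" using submodule_set_add[OF Ls(1) cy] .
  ultimately have "?L \<notin> C" using max[of ?L] by blast
  then have "finite (?Ass ?L)" using L' unfolding C_def by blast
  moreover have "?Ass L \<subseteq> insert (colon L u) (?Ass ?L)"
  proof
    fix Q assume "Q \<in> ?Ass L"
    then obtain v where v: "v \<in> carrier M" "Q = colon L v" "primeideal Q R" by blast
    show "Q \<in> insert (colon L u) (?Ass ?L)"
    \<comment> \<open>Either the multiples of \<open>v\<close> meet the added copy of R /
      \<open>colon L u\<close> nontrivially, and then the two primes agree, or \<open>v\<close>
      keeps its annihilator modulo the larger submodule.\<close>
    proof (cases "\<exists>r\<in>carrier R. r \<odot>\<^bsub>M\<^esub> v \<in> ?L \<and> r \<odot>\<^bsub>M\<^esub> v \<notin> L")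
      case True
      then obtain r where r: "r \<in> carrier R" "r \<odot>\<^bsub>M\<^esub> v \<in> ?L" "r \<odot>\<^bsub>M\<^esub> v \<notin> L" by blast
      then obtain n t where nt: "n \<in> L" "t \<in> carrier R" "r \<odot>\<^bsub>M\<^esub> v = n \<oplus>\<^bsub>M\<^esub> t \<odot>\<^bsub>M\<^esub> u"
        unfolding mem_add_cyclic_iff by blast
      have nc: "n \<in> carrier M" using nt submodule_carrier[OF Ls(1)] by blast
      have tu: "t \<odot>\<^bsub>M\<^esub> u \<notin> L" using r nt add_mem_iff[OF Ls(1)] u by simp
      have "a \<odot>\<^bsub>M\<^esub> (r \<odot>\<^bsub>M\<^esub> v) \<in> L \<longleftrightarrow> a \<odot>\<^bsub>M\<^esub> (t \<odot>\<^bsub>M\<^esub> u) \<in> L" if a: "a \<in> carrier R" for a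
        using a nt nc u add_mem_iff[OF Ls(1)] submoduleE(4)[OF Ls(1)] by (simp add: smult_r_distr)
      then have "colon L (r \<odot>\<^bsub>M\<^esub> v) = colon L (t \<odot>\<^bsub>M\<^esub> u)" by (auto simp: colon_def)
      moreover have "colon L (r \<odot>\<^bsub>M\<^esub> v) = Q"
        using colon_smult_prime[OF Ls(1) v(1)] v r by simp
      moreover have "colon L (t \<odot>\<^bsub>M\<^esub> u) = colon L u"
        using colon_smult_prime[OF Ls(1) u(1)] u nt tu by simp
      ultimately show ?thesis by blast
    next
      case False
      then have "colon ?L v = colon L v" using \<open>L \<subseteq> ?L\<close> unfolding colon_def by blast
      then show ?thesis using v by auto
    qed
  qed
  ultimately show False using Ls(2) finite_subset by blast
qed

text \<open>A prime above the annihilator is in the support of M, so by Nakayama M differs from P M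
  locally at \<open>P\<close>. Since \<open>t\<close> is a unit there, t M is not inside P M;
  \<open>L\<close> is a submodule containing P M that witnesses this.\<close>

lemma ex_support_submodule:
  assumes P: "primeideal P R" and ann: "annihilator R M \<subseteq> P" and t: "t \<in> carrier R - P"
  obtains L u where "submodule L R M" "\<And>p u. p \<in> P \<Longrightarrow> u \<in> carrier M \<Longrightarrow> p \<odot>\<^bsub>M\<^esub> u \<in> L"
    "u \<in> carrier M" "t \<odot>\<^bsub>M\<^esub> u \<notin> L"
proof (rule ccontr)
  interpret P: primeideal P R by (rule P)
  note * = that
  assume neg: "\<not> thesis"
  have "carrier M \<subseteq> saturation P {\<zero>\<^bsub>M\<^esub>}"
  proof (rule nakayama[OF P])
    show "submodule (saturation P {\<zero>\<^bsub>M\<^esub>}) R M"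
      by (rule submodule_saturation[OF P submodule_singleton_zero])
    show "saturated P (saturation P {\<zero>\<^bsub>M\<^esub>})" by (rule saturated_saturation[OF P])
  next
    fix L assume L: "submodule L R M" "saturated P L"
      "\<And>p u. p \<in> P \<Longrightarrow> u \<in> carrier M \<Longrightarrow> p \<odot>\<^bsub>M\<^esub> u \<in> L"
    then have "t \<odot>\<^bsub>M\<^esub> u \<in> L" if "u \<in> carrier M" for u using neg * that by blast
    then show "carrier M \<subseteq> L" using L(2) t unfolding saturated_def by blast
  qed simp
  then have tors: "\<exists>s\<in>carrier R - P. s \<odot>\<^bsub>M\<^esub> u = \<zero>\<^bsub>M\<^esub>" if "u \<in> carrier M" for u
    using that unfolding saturation_def by blast
  \<comment> \<open>So far each element has its own killer outside \<open>P\<close>. A maximal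
    kernel makes the killer uniform, and a uniform one would lie in the annihilator of M.\<close>
  define ker where "ker s = {u \<in> carrier M. s \<odot>\<^bsub>M\<^esub> u = \<zero>\<^bsub>M\<^esub>}" for s
  have ker: "submodule (ker s) R M" if "s \<in> carrier R" for s
    by (rule submoduleI')
      (use that smult_left_commute[OF that] in \<open>auto simp: ker_def smult_r_distr\<close>)
  have "ker ` (carrier R - P) \<noteq> {}" using t by blast
  moreover have "submodule N R M" if "N \<in> ker ` (carrier R - P)" for N using that ker by blast
  ultimately obtain N where N: "N \<in> ker ` (carrier R - P)"
    and max: "\<And>L. L \<in> ker ` (carrier R - P) \<Longrightarrow> N \<subseteq> L \<Longrightarrow> L = N"
    using ex_maximal_submodule[of "ker ` (carrier R - P)"] by metis
  then obtain s where s: "s \<in> carrier R - P" "N = ker s" by blast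
  have "u \<in> ker s" if u: "u \<in> carrier M" for u
  proof -
    obtain r where r: "r \<in> carrier R - P" "r \<odot>\<^bsub>M\<^esub> u = \<zero>\<^bsub>M\<^esub>" using tors u by blast
    have "ker s \<subseteq> ker (r \<otimes> s)" using r s by (auto simp: ker_def smult_assoc1)
    then have "ker (r \<otimes> s) = ker s" using max[of "ker (r \<otimes> s)"] s r P.mult_notin by blast
    moreover have "u \<in> ker (r \<otimes> s)"
      using u r s smult_left_commute[of r s u] by (simp add: ker_def smult_assoc1)
    ultimately show ?thesis by blast
  qed
  then have "s \<in> annihilator R M" using s by (auto simp: annihilator_def ker_def)
  then show False using ann s by blast
qed

end

locale local_noetherian_module = noetherian_ring_module R M + noetherian_local_ring R
  for R (structure) and M (structure)

context noetherian_local_ring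
begin

lemma maximalideal_max_ideal: "maximalideal (max_ideal R) R"
  unfolding max_ideal_def using unique_maximalideal by (rule theI')

lemma primeideal_max_ideal: "primeideal (max_ideal R) R"
  using maximalideal_max_ideal by (rule maximalideal_prime)

lemma proper_ideal_subset_max_ideal:
  assumes J: "ideal J R" "\<one> \<notin> J" shows "J \<subseteq> max_ideal R"
proof -
  define C where "C = {I. ideal I R \<and> J \<subseteq> I \<and> \<one> \<notin> I}"
  have "C \<noteq> {}" using J unfolding C_def by blast
  moreover have "ideal I R" if "I \<in> C" for I using that unfolding C_def by simp
  ultimately obtain I where I: "I \<in> C" and max: "\<And>J. J \<in> C \<Longrightarrow> I \<subseteq> J \<Longrightarrow> J = I"
    using ex_maximal_ideal[of C] by metis
  have "maximalideal I R"
  proof (rule maximalidealI)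
    show "ideal I R" "carrier R \<noteq> I" using I unfolding C_def by auto
  next
    fix K assume K: "ideal K R" "I \<subseteq> K" "K \<subseteq> carrier R"
    show "K = I \<or> K = carrier R"
    proof (cases "\<one> \<in> K")
      case True
      then show ?thesis using ideal.one_imp_carrier[OF K(1)] by blast
    next
      case False
      then show ?thesis using max[of K] K I unfolding C_def by blast
    qed
  qed
  then have "I = max_ideal R" using unique_maximalideal maximalideal_max_ideal by blast
  then show ?thesis using I unfolding C_def by blast
qed

lemma primeideal_subset_max_ideal: "primeideal P R \<Longrightarrow> P \<subseteq> max_ideal R"
  using proper_ideal_subset_max_ideal primeideal.one_notin primeideal.axioms(1) by blast

end

context local_noetherian_module
begin

text \<open>Elements outside the maximal ideal are units, so localising there changes
  nothing.\<close>

lemma saturated_max_ideal: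
  assumes N: "submodule N R M" shows "saturated (max_ideal R) N"
  unfolding saturated_def
proof (intro ballI impI)
  fix s u assume su: "s \<in> carrier R - max_ideal R" "u \<in> carrier M" "s \<odot>\<^bsub>M\<^esub> u \<in> N"
  have "\<not> PIdl s \<subseteq> max_ideal R" using cgenideal_self su by blast
  then have "\<one> \<in> PIdl s"
    using proper_ideal_subset_max_ideal[of "PIdl s"] cgenideal_ideal su by blast
  then obtain t where t: "t \<in> carrier R" "\<one> = t \<otimes> s" unfolding cgenideal_def by blast
  then have "t \<odot>\<^bsub>M\<^esub> (s \<odot>\<^bsub>M\<^esub> u) = u" 
    using su t(1) smult_assoc1[of t s u] smult_one[of u] by simp
  then show "u \<in> N" using submoduleE(4)[OF N t(1) su(3)] by simp
qed

lemma nakayama_local: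
  assumes x: "x \<in> max_ideal R" and N: "submodule N R M" and H: "submodule H R M"
    and sub: "H \<subseteq> N <+>\<^bsub>M\<^esub> multiples x H"
  shows "H \<subseteq> N"
proof (rule nakayama[OF primeideal_max_ideal N saturated_max_ideal[OF N] submoduleE(1)[OF H]])
  fix L assume L: "submodule L R M" "N \<subseteq> L" "\<And>p u. p \<in> max_ideal R \<Longrightarrow> u \<in> H \<Longrightarrow> p \<odot>\<^bsub>M\<^esub> u \<in> L"
  have "multiples x H \<subseteq> L" using L(3) x by (auto simp: multiples_def)
  then show "H \<subseteq> L" using sub set_add_least[OF L(1,2)] by blast
qed

end

section \<open>Krull's height theorem\<close>

text \<open>The ring as a module over itself. Its submodules are the ideals, which lets the
  saturation lemmas act on ideals in the height theorem.\<close>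

definition regular_module :: "('a, 'r) ring_scheme \<Rightarrow> ('a, 'a) module" where
  "regular_module R = \<lparr>carrier = carrier R, monoid.mult = mult R, one = one R,
     ring.zero = zero R, add = add R, smult = mult R\<rparr>"

lemma regular_module_simps [simp]:
  "carrier (regular_module R) = carrier R"
  "zero (regular_module R) = zero R"
  "add (regular_module R) = add R"
  "smult (regular_module R) = mult R"
  by (simp_all add: regular_module_def)

lemma (in cring) module_regular_module: "module R (regular_module R)"
proof (rule moduleI)
  show "abelian_group (regular_module R)"
  proof (rule abelian_groupI)
    fix u assume "u \<in> carrier (regular_module R)"
    then show "\<exists>v\<in>carrier (regular_module R). v \<oplus>\<^bsub>regular_module R\<^esub> u = \<zero>\<^bsub>regular_module R\<^esub>"
      using l_neg[of u] by auto
  qed (simp_all add: a_ac)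
qed (simp_all add: is_cring l_distr r_distr m_assoc)

lemma (in cring) submodule_regular_module_iff:
  "submodule I R (regular_module R) \<longleftrightarrow> ideal I R"
proof -
  interpret M: module R "regular_module R" by (rule module_regular_module)
  have "submodule I R (regular_module R)" if "ideal I R"
  proof -
    interpret ideal I R by (rule that)
    show ?thesis by (rule M.submoduleI') (auto simp: I_l_closed)
  qed
  moreover have "ideal I R" if I: "submodule I R (regular_module R)"
  proof (rule idealI)
    show "ring R" by (rule ring_axioms)
    show "subgroup I (add_monoid R)"
      using submodule.axioms(1)[OF I] by (simp add: subgroup_def a_inv_def m_inv_def)
    have *: "x \<otimes> a \<in> I" if "a \<in> I" "x \<in> carrier R" for a x
      using M.submoduleE(4)[OF I that(2,1)] by simp
    then show "x \<otimes> a \<in> I" if "a \<in> I" "x \<in> carrier R" for a x using that .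
    show "a \<otimes> x \<in> I" if "a \<in> I" "x \<in> carrier R" for a x
      using *[OF that] that m_comm[of a x] M.submodule_carrier[OF I that(1)] by simp
  qed
  ultimately show ?thesis by blast
qed

lemma noetherian_module_regular_module:
  assumes "cring R" "noetherian_ring R"
  shows "noetherian_ring_module R (regular_module R)"
proof -
  interpret cring R by fact
  interpret noetherian_ring R by fact
  interpret M: module R "regular_module R" by (rule module_regular_module)
  show ?thesis
  proof
    fix C :: "'a set set"
    assume "C \<noteq> {}" "\<And>N. N \<in> C \<Longrightarrow> submodule N R (regular_module R)"
    then show "\<exists>N\<in>C. \<forall>L\<in>C. N \<subseteq> L \<longrightarrow> L = N"
      using ex_maximal_ideal[of C] submodule_regular_module_iff by blast
  qed
qed

context module
begin

lemma submodule_submodule_span: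
  assumes "S \<subseteq> carrier M" shows "submodule (submodule_span R M S) R M"
proof (rule submoduleI')
  show "submodule_span R M S \<subseteq> carrier M"
    unfolding submodule_span_def using assms carrier_is_submodule by blast
qed (auto simp: submodule_span_def submodule_zero submoduleE(4,5))

lemma submodule_span_upper: "S \<subseteq> submodule_span R M S"
  unfolding submodule_span_def by blast

lemma submodule_span_least: "submodule N R M \<Longrightarrow> S \<subseteq> N \<Longrightarrow> submodule_span R M S \<subseteq> N"
  unfolding submodule_span_def by blast

lemma set_add_mono: "A \<subseteq> B \<Longrightarrow> C \<subseteq> D \<Longrightarrow> A <+>\<^bsub>M\<^esub> C \<subseteq> B <+>\<^bsub>M\<^esub> D"
  unfolding mem_set_add_iff subset_iff by blast

lemma saturation_mono: "A \<subseteq> B \<Longrightarrow> saturation P A \<subseteq> saturation P B"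
  unfolding saturation_def by blast

lemma saturated_mono: "saturated Q N \<Longrightarrow> Q \<subseteq> P \<Longrightarrow> saturated P N"
  unfolding saturated_def by blast

end

context noetherian_ring_module
begin

text \<open>\<open>J\<close> kills M / \<open>K\<close> and \<open>P\<close> is minimal over
  \<open>J\<close>, so the quotient is artinian locally at \<open>P\<close>. Noetherian induction on
  the lower bound \<open>A\<close> of the chain takes the place of length: each step adds one copy
  of the residue field of \<open>P\<close> to \<open>A\<close>.\<close>

lemma saturated_chain_stable:
  assumes P: "primeideal P R"
    and JK: "J \<subseteq> carrier R" "\<And>p u. p \<in> J \<Longrightarrow> u \<in> carrier M \<Longrightarrow> p \<odot>\<^bsub>M\<^esub> u \<in> K"
    and minimal: "\<And>Q. \<lbrakk>primeideal Q R; J \<subseteq> Q; Q \<subseteq> P\<rbrakk> \<Longrightarrow> Q = P"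
    and I: "\<And>n. submodule (I n) R M" "\<And>n. saturated P (I n)" "\<And>n. K \<subseteq> I n"
      "\<And>n. I (Suc n) \<subseteq> I n"
    and K: "submodule K R M"
  shows "\<exists>n. I (Suc n) = I n"
proof -
  interpret P: primeideal P R by (rule P)
  define chain where "chain A I \<longleftrightarrow> (\<forall>n. submodule (I n) R M \<and> saturated P (I n) \<and>
    A \<subseteq> I n \<and> I (Suc n) \<subseteq> I n)" for A and I :: "nat \<Rightarrow> 'c set"
  define bad where "bad A \<longleftrightarrow> submodule A R M \<and> saturated P A \<and> K \<subseteq> A \<and>
    (\<exists>I. chain A I \<and> (\<forall>n. \<exists>k\<ge>n. I k \<noteq> I n))" for A
  have "\<not> bad A" for A
  proof
    assume "bad A"
    then have "{A. bad A} \<noteq> {}" by blast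
    moreover have "submodule N R M" if "N \<in> {A. bad A}" for N using that unfolding bad_def by simp
    ultimately obtain A where A: "bad A" and max: "\<And>L. bad L \<Longrightarrow> A \<subseteq> L \<Longrightarrow> L = A"
      using ex_maximal_submodule[of "{A. bad A}"] by (metis mem_Collect_eq)
    then obtain I where I: "chain A I" "\<And>n. \<exists>k\<ge>n. I k \<noteq> I n" unfolding bad_def by blast
    have As: "submodule A R M" "saturated P A" "K \<subseteq> A" using A unfolding bad_def by blast+
    have In: "submodule (I n) R M" "saturated P (I n)" "A \<subseteq> I n" "I (Suc n) \<subseteq> I n" for n
      using I(1) unfolding chain_def by blast+
    have anti: "I k \<subseteq> I n" if "n \<le> k" for n k
      using lift_Suc_antimono_le[of I, OF In(4) that] .
    obtain b0 where b0: "b0 \<in> carrier M" "b0 \<notin> A"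
    proof -
      have "I k = carrier M" if "carrier M \<subseteq> A" for k
        using that In(1,3) submoduleE(1) by blast
      then show ?thesis using I(2)[of 0] that by blast
    qed
    have "colon A b0 \<subseteq> P"
    proof
      fix a assume a: "a \<in> colon A b0"
      then show "a \<in> P" using As(2) b0 unfolding saturated_def colon_def by blast
    qed
    then obtain r where r: "r \<in> carrier R" "primeideal (colon A (r \<odot>\<^bsub>M\<^esub> b0)) R"
      "colon A (r \<odot>\<^bsub>M\<^esub> b0) \<subseteq> P"
      using ex_associated_prime[OF As(1) b0(1) P] by blast
    define b where "b = r \<odot>\<^bsub>M\<^esub> b0"
    have b: "b \<in> carrier M" using b0 r b_def by simp
    \<comment> \<open>An associated prime of M / \<open>A\<close> inside \<open>P\<close> contains
      \<open>J\<close>, hence equals \<open>P\<close>. Therefore \<open>A'\<close> below is locally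
      a simple extension of \<open>A\<close>, which is the content of \<open>dich\<close>.\<close>
    have colP: "colon A b = P"
    proof (rule minimal)
      show "J \<subseteq> colon A b" using JK As(3) b unfolding colon_def by blast
    qed (use r b_def in auto)
    have bA: "b \<notin> A" using colon_prime_notin[OF b, of A] colP P by simp
    have cy: "submodule (cyclic b) R M" using submodule_cyclic b by blast
    let ?B = "A <+>\<^bsub>M\<^esub> cyclic b"
    define A' where "A' = saturation P ?B"
    have B: "submodule ?B R M" using submodule_set_add[OF As(1) cy] .
    have A's: "submodule A' R M" "saturated P A'"
      unfolding A'_def by (rule submodule_saturation[OF P B], rule saturated_saturation[OF P])
    have BA': "?B \<subseteq> A'" unfolding A'_def using saturation_upper[OF P] submoduleE(1)[OF B] by blast
    have AA': "A \<subseteq> A'" "b \<in> A'"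
      using set_add_upper[OF As(1) cy] cyclic_self[OF b] BA' by auto
    have notbad: "\<not> bad A'" using max[of A'] AA' bA by blast
    have A'K: "K \<subseteq> A'" using AA' As by blast
    have dich: "A' \<subseteq> L" if L: "submodule L R M" "saturated P L" "A \<subseteq> L"
      and c: "c \<in> L" "c \<in> A'" "c \<notin> A" for L c
    proof -
      have cc: "c \<in> carrier M" using c L submodule_carrier by blast
      obtain s where s: "s \<in> carrier R - P" "s \<odot>\<^bsub>M\<^esub> c \<in> ?B"
        using c unfolding A'_def saturation_def by blast
      then obtain a t where t: "a \<in> A" "t \<in> carrier R" "s \<odot>\<^bsub>M\<^esub> c = a \<oplus>\<^bsub>M\<^esub> t \<odot>\<^bsub>M\<^esub> b"
        unfolding mem_add_cyclic_iff by blast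
      have "s \<odot>\<^bsub>M\<^esub> c \<in> L" using submoduleE(4)[OF L(1)] s c by blast
      then have tb: "t \<odot>\<^bsub>M\<^esub> b \<in> L" using add_mem_iff[OF L(1), of a "t \<odot>\<^bsub>M\<^esub> b"] t L(3) b by auto
      have "s \<odot>\<^bsub>M\<^esub> c \<notin> A" using As(2) s cc c unfolding saturated_def by blast
      then have "t \<odot>\<^bsub>M\<^esub> b \<notin> A" using add_mem_iff[OF As(1), of a "t \<odot>\<^bsub>M\<^esub> b"] t b by auto
      then have "t \<notin> P" using colP by (auto simp: colon_def)
      then have "b \<in> L" using L(2) tb t b unfolding saturated_def by blast
      then have "?B \<subseteq> L" using set_add_least[OF L(1,3)] cyclic_least[OF L(1)] by blast
      then show ?thesis unfolding A'_def using saturation_least L(2) by blast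
    qed
    show False
    proof (cases "\<forall>n. A' \<subseteq> I n")
      case True
      then have "chain A' I" using In unfolding chain_def by blast
      then have "bad A'" unfolding bad_def using A's A'K I(2) by blast
      then show False using notbad by blast
    next
      case False
      then obtain n0 where n0: "\<not> A' \<subseteq> I n0" by blast
      \<comment> \<open>From \<open>n0\<close> on the chain meets \<open>A'\<close> only in
        \<open>A\<close>. The sums with \<open>A'\<close> form a chain above \<open>A'\<close>,
        which stops because \<open>A'\<close> is not bad; equal sums and equal intersections then
        force equal members, by the modular law.\<close>
      define J where "J n = saturation P (I n <+>\<^bsub>M\<^esub> A')" for n
      have IA: "submodule (I n <+>\<^bsub>M\<^esub> A') R M" for n using submodule_set_add In(1) A's(1) by blast
      have IJ: "I n <+>\<^bsub>M\<^esub> A' \<subseteq> J n" for n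
        unfolding J_def using saturation_upper[OF P] submoduleE(1)[OF IA] by blast
      have "chain A' J"
        unfolding chain_def
      proof (intro allI conjI)
        fix n
        show "submodule (J n) R M" unfolding J_def by (rule submodule_saturation[OF P IA])
        show "saturated P (J n)" unfolding J_def by (rule saturated_saturation[OF P])
        show "A' \<subseteq> J n" using IJ set_add_upper(2)[OF In(1) A's(1)] by blast
        show "J (Suc n) \<subseteq> J n"
          unfolding J_def by (rule saturation_mono[OF set_add_mono]) (use In(4) in auto)
      qed
      then obtain n1 where n1: "\<And>k. k \<ge> n1 \<Longrightarrow> J k = J n1"
        using notbad A's A'K unfolding bad_def by blast
      define n where "n = max n0 n1"
      have "I k = I n" if k: "k \<ge> n" for k
      proof
        show "I k \<subseteq> I n" using anti k by blast
        show "I n \<subseteq> I k"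
        proof
          fix c assume c: "c \<in> I n"
          have "J k = J n" using n1[of k] n1[of n] k unfolding n_def by simp
          moreover have "c \<in> J n" using c IJ set_add_upper(1)[OF In(1) A's(1)] by blast
          ultimately obtain s where s: "s \<in> carrier R - P" "s \<odot>\<^bsub>M\<^esub> c \<in> I k <+>\<^bsub>M\<^esub> A'"
            unfolding J_def saturation_def by blast
          then obtain i a where ia: "i \<in> I k" "a \<in> A'" "s \<odot>\<^bsub>M\<^esub> c = i \<oplus>\<^bsub>M\<^esub> a"
            unfolding mem_set_add_iff by blast
          have ac: "a \<in> carrier M" using ia A's submodule_carrier by blast
          have "s \<odot>\<^bsub>M\<^esub> c \<in> I n" using s c submoduleE(4)[OF In(1)] by blast
          then have "a \<in> I n" using add_mem_iff[OF In(1)[of n] _ ac] ia anti[OF k] by auto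
          moreover have "\<not> A' \<subseteq> I n" using n0 anti[of n0 n] unfolding n_def by auto
          ultimately have "a \<in> A" using dich[OF In(1-3)] ia by blast
          then have "s \<odot>\<^bsub>M\<^esub> c \<in> I k" using ia In(3)[of k] submoduleE(5)[OF In(1)[of k], of i a] by auto
          then show "c \<in> I k"
            using In(2)[of k] s c submodule_carrier[OF In(1)] unfolding saturated_def by blast
        qed
      qed
      then show False using I(2)[of n] by blast
    qed
  qed
  moreover have "\<exists>n. \<forall>k\<ge>n. I k = I n" if nb: "\<And>A. \<not> bad A"
  proof (rule ccontr)
    assume neg: "\<not> (\<exists>n. \<forall>k\<ge>n. I k = I n)"
    let ?A = "saturation P K"
    have "?A \<subseteq> I n" for n using saturation_least I by blast
    then have "chain ?A I" unfolding chain_def using I by blast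
    then have "bad ?A"
      unfolding bad_def
      using submodule_saturation[OF P K] saturated_saturation[OF P]
        saturation_upper[OF P submoduleE(1)[OF K]] neg by blast
    then show False using nb by blast
  qed
  ultimately show ?thesis using le_Suc_eq by blast
qed

end

text \<open>
  Krull's principal ideal theorem without localisation: the powers of \<open>Q\<close> in the local ring at \<open>Q\<close>
  are replaced by the \<open>Q\<close>-saturated ideals \<open>J n\<close>, and artinianity of the local ring at \<open>P\<close>
  modulo \<open>x\<close> by the descending chain condition for \<open>P\<close>-saturated ideals.
\<close>

theorem principal_ideal_theorem:
  assumes R: "cring R" "noetherian_ring R"
    and P0: "primeideal P0 R" and Q: "primeideal Q R" and P: "primeideal P R"
    and lt: "P0 \<subset> Q" "Q \<subset> P" and x: "x \<in> P"
  shows "\<exists>P'. primeideal P' R \<and> P0 \<subseteq> P' \<and> x \<in> P' \<and> P' \<subset> P"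
proof (rule ccontr)
  let ?M = "regular_module R"
  interpret M: noetherian_ring_module R ?M by (rule noetherian_module_regular_module[OF R])
  assume "\<not> ?thesis"
  then have minimal: "P' = P" if "primeideal P' R" "insert x P0 \<subseteq> P'" "P' \<subseteq> P" for P'
    using that by blast
  have sub: "submodule I R ?M" if "primeideal I R" for I
    using that M.submodule_regular_module_iff primeideal.axioms(1) by blast
  have sat: "M.saturated I I" if "primeideal I R" for I
    using primeideal.I_prime[OF that] unfolding M.saturated_def by auto
  have Qc: "Q \<subseteq> carrier R" and P0c: "P0 \<subseteq> carrier R" and xc: "x \<in> carrier R"
    using M.submoduleE(1)[OF sub] P0 Q P x by fastforce+
  have xQ: "x \<notin> Q" using minimal[OF Q] lt by blast
  \<comment> \<open>\<open>J n\<close> models the symbolic power of \<open>Q\<close> of exponent n +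
    1, taken modulo \<open>P0\<close>: each step multiplies by \<open>Q\<close>, adds
    \<open>P0\<close> and saturates at \<open>Q\<close>.\<close>
  define S where "S I = P0 \<union> {q \<otimes>\<^bsub>R\<^esub> j | q j. q \<in> Q \<and> j \<in> I}" for I
  define J where "J = rec_nat Q (\<lambda>_ I. M.saturation Q (submodule_span R ?M (S I)))"
  have J_0: "J 0 = Q" and J_Suc: "J (Suc n) = M.saturation Q (submodule_span R ?M (S (J n)))" for n
    by (simp_all add: J_def)
  have Sc: "S I \<subseteq> carrier ?M" if "submodule I R ?M" for I
    using M.submoduleE(1)[OF that] Qc P0c unfolding S_def by auto
  have J: "submodule (J n) R ?M \<and> M.saturated Q (J n) \<and> P0 \<subseteq> J n" for n
  proof (induction n)
    case 0
    then show ?case using sub sat Q lt by (auto simp: J_0)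
  next
    case (Suc n)
    let ?sp = "submodule_span R ?M (S (J n))"
    have sp: "submodule ?sp R ?M" using M.submodule_submodule_span[OF Sc] Suc by blast
    have "P0 \<subseteq> ?sp" using M.submodule_span_upper unfolding S_def by blast
    then show ?case
      unfolding J_Suc
      using M.submodule_saturation[OF Q sp] M.saturated_saturation[OF Q]
        M.saturation_upper[OF Q M.submoduleE(1)[OF sp]] by blast
  qed
  then have Js: "submodule (J n) R ?M" "M.saturated Q (J n)" "P0 \<subseteq> J n" for n by blast+
  have J_least: "J (Suc n) \<subseteq> L"
    if "submodule L R ?M" "M.saturated Q L" "P0 \<subseteq> L"
      "\<And>q j. q \<in> Q \<Longrightarrow> j \<in> J n \<Longrightarrow> q \<otimes>\<^bsub>R\<^esub> j \<in> L" for n L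
    unfolding J_Suc
    by (rule M.saturation_least[OF that(2) M.submodule_span_least[OF that(1)]])
      (use that in \<open>auto simp: S_def\<close>)
  have J_mult: "q \<otimes>\<^bsub>R\<^esub> j \<in> J (Suc n)" if "q \<in> Q" "j \<in> J n" for n q j
  proof -
    let ?sp = "submodule_span R ?M (S (J n))"
    have "submodule ?sp R ?M" using M.submodule_submodule_span[OF Sc] Js by blast
    then have "?sp \<subseteq> J (Suc n)"
      unfolding J_Suc using M.saturation_upper[OF Q] M.submoduleE(1) by blast
    moreover have "q \<otimes>\<^bsub>R\<^esub> j \<in> ?sp"
      using M.submodule_span_upper[of "S (J n)"] that unfolding S_def by blast
    ultimately show ?thesis by blast
  qed
  have J_anti: "J (Suc n) \<subseteq> J n" for n
    by (rule J_least) (use Js M.submoduleE(4)[OF Js(1)] Qc in auto)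
  have JP: "M.saturated P (J n)" for n using M.saturated_mono[OF Js(2)] lt by blast
  have mx: "submodule (M.multiples x (carrier R)) R ?M"
    using M.submodule_multiples[OF M.carrier_is_submodule] xc by simp
  have Jx: "submodule (J n <+>\<^bsub>?M\<^esub> M.multiples x (carrier R)) R ?M" for n
    using M.submodule_set_add[OF Js(1) mx] .
  \<comment> \<open>Minimality of \<open>P\<close> over \<open>x\<close> and \<open>P0\<close> makes
    the ring modulo these artinian locally at \<open>P\<close>, so the images of the symbolic powers
    stop falling.\<close>
  define I where "I n = M.saturation P (J n <+>\<^bsub>?M\<^esub> M.multiples x (carrier R))" for n
  have "\<exists>n. I (Suc n) = I n"
  proof (rule M.saturated_chain_stable[OF P, where J = "insert x P0"])
    let ?K = "P0 <+>\<^bsub>?M\<^esub> M.multiples x (carrier R)"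
    show "submodule ?K R ?M" using M.submodule_set_add[OF sub[OF P0] mx] .
    show "insert x P0 \<subseteq> carrier R" using xc P0c by blast
    show "p \<odot>\<^bsub>?M\<^esub> u \<in> ?K" if "p \<in> insert x P0" "u \<in> carrier ?M" for p u
    proof (cases "p = x")
      case True
      then have "p \<odot>\<^bsub>?M\<^esub> u \<in> M.multiples x (carrier R)" using that by (simp add: M.multiples_def)
      then show ?thesis using M.set_add_upper(2)[OF sub[OF P0] mx] by blast
    next
      case False
      then have "p \<otimes>\<^bsub>R\<^esub> u \<in> P0"
        using that ideal.I_r_closed[OF primeideal.axioms(1)[OF P0]] by auto
      then show ?thesis using M.set_add_upper(1)[OF sub[OF P0] mx] by auto
    qed
  next
    fix n
    show "submodule (I n) R ?M" unfolding I_def by (rule M.submodule_saturation[OF P Jx])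
    show "M.saturated P (I n)" unfolding I_def by (rule M.saturated_saturation[OF P])
    have "P0 <+>\<^bsub>?M\<^esub> M.multiples x (carrier R) \<subseteq> J n <+>\<^bsub>?M\<^esub> M.multiples x (carrier R)"
      by (rule M.set_add_mono[OF Js(3)]) simp
    then show "P0 <+>\<^bsub>?M\<^esub> M.multiples x (carrier R) \<subseteq> I n"
      unfolding I_def using M.saturation_upper[OF P M.submoduleE(1)[OF Jx]] by blast
    show "I (Suc n) \<subseteq> I n"
      unfolding I_def by (rule M.saturation_mono[OF M.set_add_mono[OF J_anti]]) simp
  qed (use minimal in auto)
  then obtain n where n: "I (Suc n) = I n" by blast
  have Jcar: "J n \<subseteq> carrier R" for n using M.submoduleE(1)[OF Js(1)] by simp
  \<comment> \<open>Locally at \<open>P\<close>, \<open>J n\<close> is contained in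
    \<open>J (Suc n)\<close> plus \<open>x\<close> times \<open>J n\<close>: when \<open>x\<close>
    times \<open>c\<close> lies in \<open>J n\<close>, so does \<open>c\<close>, because
    \<open>x\<close> is outside \<open>Q\<close> and \<open>J n\<close> is saturated at
    \<open>Q\<close>. Nakayama at \<open>P\<close> removes the second summand.\<close>
  have "J n \<subseteq> J (Suc n)"
  proof (rule M.nakayama[OF P Js(1) JP])
    fix L assume L: "submodule L R ?M" "M.saturated P L" "J (Suc n) \<subseteq> L"
      and mult: "\<And>p u. p \<in> P \<Longrightarrow> u \<in> J n \<Longrightarrow> p \<odot>\<^bsub>?M\<^esub> u \<in> L"
    have xL: "x \<otimes>\<^bsub>R\<^esub> c \<in> L" if "c \<in> J n" for c using mult[OF x that] by simp
    show "J n \<subseteq> L"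
    proof
      fix a assume a: "a \<in> J n"
      have "a \<in> J n <+>\<^bsub>?M\<^esub> M.multiples x (carrier R)"
        using M.set_add_upper(1)[OF Js(1)[of n] mx] a by (rule subsetD)
      then have "a \<in> I n"
        unfolding I_def using M.saturation_upper[OF P M.submoduleE(1)[OF Jx[of n]]] by (rule rev_subsetD)
      then have "a \<in> I (Suc n)" using n by simp
      then obtain s where s: "s \<in> carrier R - P"
        "s \<otimes>\<^bsub>R\<^esub> a \<in> J (Suc n) <+>\<^bsub>?M\<^esub> M.multiples x (carrier R)"
        unfolding I_def M.saturation_def by auto
      then obtain b c where bc: "b \<in> J (Suc n)" "c \<in> carrier R" "s \<otimes>\<^bsub>R\<^esub> a = b \<oplus>\<^bsub>R\<^esub> x \<otimes>\<^bsub>R\<^esub> c"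
        unfolding M.mem_add_multiples_iff by auto
      have "s \<otimes>\<^bsub>R\<^esub> a \<in> J n" using M.submoduleE(4)[OF Js(1), of s a n] s a by simp
      then have "x \<otimes>\<^bsub>R\<^esub> c \<in> J n"
        using M.add_mem_iff[OF Js(1)[of n], of b "x \<otimes>\<^bsub>R\<^esub> c"] bc xc J_anti[of n] by auto
      then have "c \<in> J n" using Js(2)[of n] xc xQ bc unfolding M.saturated_def by simp
      then have "x \<otimes>\<^bsub>R\<^esub> c \<in> L" by (rule xL)
      then have "s \<otimes>\<^bsub>R\<^esub> a \<in> L" using M.submoduleE(5)[OF L(1), of b "x \<otimes>\<^bsub>R\<^esub> c"] bc L(3) by auto
      then show "a \<in> L" using L(2) s a Jcar unfolding M.saturated_def by auto
    qed
  qed (use Jcar in auto)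
  then have Jn: "J n = J (Suc n)" using J_anti by blast
  \<comment> \<open>With two consecutive powers equal, \<open>J n\<close> is locally
    \<open>P0\<close> plus \<open>Q\<close> times itself, and Nakayama at \<open>Q\<close> leaves
    only \<open>P0\<close>.\<close>
  have "J n \<subseteq> P0"
  proof (rule M.nakayama[OF Q sub[OF P0]])
    show "M.saturated Q P0" using M.saturated_mono[OF sat[OF P0]] lt by blast
  next
    fix L assume L: "submodule L R ?M" "M.saturated Q L" "P0 \<subseteq> L"
      and mult: "\<And>p u. p \<in> Q \<Longrightarrow> u \<in> J n \<Longrightarrow> p \<odot>\<^bsub>?M\<^esub> u \<in> L"
    show "J n \<subseteq> L" using J_least[OF L, of n] mult Jn by simp
  qed (use Jcar in auto)
  \<comment> \<open>Primality of \<open>P0\<close> descends through the powers to \<open>Q\<close>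
    itself, against \<open>P0\<close> being strictly smaller than \<open>Q\<close>.\<close>
  moreover have "Q \<subseteq> P0" if "J n \<subseteq> P0" for n
    using that
  proof (induction n)
    case 0
    then show ?case by (simp add: J_0)
  next
    case (Suc n)
    show ?case
    proof (cases "J n \<subseteq> P0")
      case False
      then obtain j where j: "j \<in> J n" "j \<notin> P0" by blast
      have "q \<in> P0" if q: "q \<in> Q" for q
      proof -
        have "q \<otimes>\<^bsub>R\<^esub> j \<in> P0" using J_mult[OF q j(1)] Suc.prems by blast
        moreover have "q \<in> carrier R" "j \<in> carrier R" using q Qc j Jcar by auto
        ultimately show ?thesis using primeideal.I_prime[OF P0] j(2) by blast
      qed
      then show ?thesis by blast
    qed (use Suc in blast)
  qed
  ultimately show False using lt by blast
qed

definition prime_chain :: "('a, 'r) ring_scheme \<Rightarrow> (nat \<Rightarrow> 'a set) \<Rightarrow> nat \<Rightarrow> bool" where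
  "prime_chain R f n \<longleftrightarrow> (\<forall>i\<le>n. primeideal (f i) R) \<and> (\<forall>i<n. f i \<subset> f (Suc i))"

lemma prime_chain_mono:
  assumes "prime_chain R f n" "i \<le> j" "j \<le> n" shows "f i \<subseteq> f j"
  using assms(2,3)
proof (induction rule: dec_induct)
  case (step j)
  then show ?case using assms(1) unfolding prime_chain_def
    by (meson Suc_le_lessD dual_order.trans less_imp_le_nat psubset_imp_subset)
qed simp

lemma prime_chain_Suc_upd:
  assumes "prime_chain R f n" "primeideal P R" "f n \<subset> P"
  shows "prime_chain R (f(Suc n := P)) (Suc n)"
  using assms unfolding prime_chain_def by (auto simp: less_Suc_eq le_Suc_eq)

lemma prime_chain_upd_0:
  assumes f: "prime_chain R f n" and Q: "primeideal Q R" "Q \<subseteq> f 0"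
  shows "prime_chain R (f(0 := Q)) n"
  unfolding prime_chain_def
proof (intro conjI allI impI)
  fix i assume "i < n"
  then have "f i \<subset> f (Suc i)" using f unfolding prime_chain_def by blast
  then show "(f(0 := Q)) i \<subset> (f(0 := Q)) (Suc i)" using Q(2) by (cases i) auto
qed (use f Q in \<open>auto simp: prime_chain_def\<close>)

text \<open>When \<open>x\<close> lies in the top of three consecutive primes but not in the middle
  one, the principal ideal theorem replaces the middle one by a prime containing \<open>x\<close>.
  Repeating this downwards brings \<open>x\<close> to the first place above the bottom, with both
  ends fixed.\<close>

lemma prime_chain_through:
  assumes R: "cring R" "noetherian_ring R"
    and "prime_chain R f (Suc k)" "x \<in> f (Suc k)"
  shows "\<exists>g. prime_chain R g (Suc k) \<and> g 0 = f 0 \<and> g (Suc k) = f (Suc k) \<and> x \<in> g 1"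
  using assms(3,4)
proof (induction k arbitrary: f)
  case 0
  then show ?case by (intro exI[of _ f]) simp
next
  case (Suc k)
  let ?P = "f (Suc (Suc k))"
  have P: "primeideal (f k) R" "primeideal (f (Suc k)) R" "primeideal ?P R"
    "f k \<subset> f (Suc k)" "f (Suc k) \<subset> ?P"
    using Suc.prems unfolding prime_chain_def by auto
  have ch: "prime_chain R f k" using Suc.prems(1) unfolding prime_chain_def by auto
  obtain P' where P': "primeideal P' R" "f k \<subset> P'" "P' \<subset> ?P" "x \<in> P'"
  proof (cases "x \<in> f (Suc k)")
    case True
    then show ?thesis using that P by blast
  next
    case False
    obtain P' where "primeideal P' R" "f k \<subseteq> P'" "x \<in> P'" "P' \<subset> ?P"
      using principal_ideal_theorem[OF R P Suc.prems(2)] by metis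
    then show ?thesis using that[of P'] False P(4) by blast
  qed
  define h where "h = f(Suc k := P')"
  have h: "prime_chain R h (Suc k)" unfolding h_def by (rule prime_chain_Suc_upd[OF ch P'(1,2)])
  have xh: "x \<in> h (Suc k)" using P'(4) by (simp add: h_def)
  obtain g where g: "prime_chain R g (Suc k)" "g 0 = h 0" "g (Suc k) = h (Suc k)" "x \<in> g 1"
    using Suc.IH[OF h xh] by blast
  then have "prime_chain R (g(Suc (Suc k) := ?P)) (Suc (Suc k))"
    using prime_chain_Suc_upd[OF g(1) P(3)] P'(3) by (simp add: h_def)
  then show ?case
    by (intro exI[of _ "g(Suc (Suc k) := ?P)"] conjI, assumption) (use g in \<open>simp_all add: h_def\<close>)
qed

text \<open>Krull's height theorem relative to a bottom prime. Once \<open>x\<close> has been moved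
  into the second prime, dropping the bottom one shortens the chain by one and uses up one element
  of \<open>S\<close>.\<close>

lemma (in noetherian_local_ring) prime_chain_length_le:
  assumes "finite S" "S \<subseteq> max_ideal R" "prime_chain R f k"
    and "\<And>P. \<lbrakk>primeideal P R; f 0 \<subseteq> P; S \<subseteq> P\<rbrakk> \<Longrightarrow> P = max_ideal R"
  shows "k \<le> card S"
  using assms
proof (induction S arbitrary: f k)
  case empty
  show ?case
  proof (cases k)
    case (Suc k')
    then have "primeideal (f 0) R" "primeideal (f 1) R" "f 0 \<subset> f 1"
      using empty.prems(2) unfolding prime_chain_def by auto
    then show ?thesis using empty.prems(3)[of "f 0"] empty.prems(3)[of "f 1"] by auto
  qed simp
next
  case (insert x S)
  show ?case
  proof (cases k)
    case (Suc k')
    have ch: "prime_chain R f k'" and fk: "f k' \<subset> f k" "primeideal (f k) R"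
      using insert.prems(2) Suc unfolding prime_chain_def by auto
    \<comment> \<open>The top prime is raised to the maximal ideal, so that it is certain to contain
      \<open>x\<close>.\<close>
    have "f k' \<subset> max_ideal R" using fk primeideal_subset_max_ideal by blast
    then have "prime_chain R (f(Suc k' := max_ideal R)) (Suc k')"
      using prime_chain_Suc_upd[OF ch primeideal_max_ideal] by blast
    moreover have "x \<in> (f(Suc k' := max_ideal R)) (Suc k')" using insert.prems(1) by simp
    ultimately obtain g where g: "prime_chain R g (Suc k')" "g 0 = f 0" "x \<in> g 1"
      using prime_chain_through[OF is_cring noetherian_ring_axioms, of "f(Suc k' := max_ideal R)" k' x]
      by auto
    have "k' \<le> card S"
    proof (rule insert.IH)
      show "prime_chain R (\<lambda>i. g (Suc i)) k'" using g(1) unfolding prime_chain_def by auto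
      fix P assume P: "primeideal P R" "g (Suc 0) \<subseteq> P" "S \<subseteq> P"
      then show "P = max_ideal R"
        using insert.prems(3)[of P] g prime_chain_mono[OF g(1), of 0 1] by auto
    qed (use insert.prems in auto)
    then show ?thesis using insert Suc by simp
  qed simp
qed

section \<open>Regular elements and depth\<close>

context cring
begin

lemma ex_mem_ideals_notin_prime:
  assumes P: "primeideal P R" and I: "ideal I R" "\<not> I \<subseteq> P"
    and G: "finite G" "\<And>J. J \<in> G \<Longrightarrow> ideal J R" "\<And>J. J \<in> G \<Longrightarrow> \<not> J \<subseteq> P"
  shows "\<exists>w\<in>I. w \<notin> P \<and> (\<forall>J\<in>G. w \<in> J)"
  using G
proof (induction G)
  case empty
  then show ?case using I by blast
next
  case (insert J G)
  then obtain w where w: "w \<in> I" "w \<notin> P" "\<forall>J\<in>G. w \<in> J" by (metis insertCI)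
  obtain v where v: "v \<in> J" "v \<notin> P" using insert.prems(2) by blast
  have J: "ideal J R" using insert.prems by simp
  have c: "w \<in> carrier R" "v \<in> carrier R" using ideal.Icarr[OF I(1) w(1)] ideal.Icarr[OF J v(1)] by auto
  have "w \<otimes> v \<in> I" using ideal.I_r_closed[OF I(1) w(1) c(2)] .
  moreover have "w \<otimes> v \<notin> P" using primeideal.I_prime[OF P c] w v by blast
  moreover have "w \<otimes> v \<in> J" using ideal.I_l_closed[OF J v(1) c(1)] .
  moreover have "w \<otimes> v \<in> K" if "K \<in> G" for K
    using ideal.I_r_closed[OF insert.prems(1)[of K] _ c(2), of w] w(3) that by simp
  ultimately show ?case by blast
qed

lemma prime_avoidance:
  assumes I: "ideal I R" and F: "finite F" "\<And>P. P \<in> F \<Longrightarrow> primeideal P R" "\<And>P. P \<in> F \<Longrightarrow> \<not> I \<subseteq> P"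
  shows "\<exists>z\<in>I. \<forall>P\<in>F. z \<notin> P"
  using F
proof (induction F)
  case empty
  then show ?case using additive_subgroup.zero_closed[OF ideal.axioms(1)[OF I]] by blast
next
  case (insert P F)
  then obtain z where z: "z \<in> I" "\<forall>Q\<in>F. z \<notin> Q" by auto
  show ?case
  proof (cases "z \<in> P")
    case False
    then show ?thesis using z by blast
  next
    case True
    have P: "primeideal P R" using insert.prems by simp
    have id: "ideal Q R" if "Q \<in> insert P F" for Q
      using insert.prems(1)[OF that] by (rule primeideal.axioms)
    \<comment> \<open>Adding \<open>w\<close> moves \<open>z\<close> out of \<open>P\<close>. Primes
      not inside \<open>P\<close> contain \<open>w\<close> and so remain avoided; primes inside
      \<open>P\<close> are avoided together with \<open>P\<close>.\<close>
    have "\<exists>w\<in>I. w \<notin> P \<and> (\<forall>Q\<in>{Q \<in> F. \<not> Q \<subseteq> P}. w \<in> Q)"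
      by (rule ex_mem_ideals_notin_prime[OF P I]) (use insert id in auto)
    then obtain w where w: "w \<in> I" "w \<notin> P" "\<And>Q. Q \<in> F \<Longrightarrow> \<not> Q \<subseteq> P \<Longrightarrow> w \<in> Q" by blast
    have c: "z \<in> carrier R" "w \<in> carrier R" using ideal.Icarr[OF I] z w by blast+
    have cancel: "w \<in> Q" if "ideal Q R" "z \<in> Q" "z \<oplus> w \<in> Q" for Q
    proof -
      have "(w \<oplus> z) \<ominus> z = w" using c by (simp add: minus_eq a_assoc r_neg)
      then show ?thesis using ideal.diff_closed[OF that(1,3,2)] c by (simp add: a_comm)
    qed
    have cancel': "z \<in> Q" if "ideal Q R" "w \<in> Q" "z \<oplus> w \<in> Q" for Q
    proof -
      have "(z \<oplus> w) \<ominus> w = z" using c by (simp add: minus_eq a_assoc r_neg)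
      then show ?thesis using ideal.diff_closed[OF that(1,3,2)] by simp
    qed
    have zP: "z \<oplus> w \<notin> P" using cancel[of P] id True w by blast
    have "z \<oplus> w \<notin> Q" if Q: "Q \<in> F" for Q
    proof (cases "Q \<subseteq> P")
      case False
      then show ?thesis using w(3)[OF Q] cancel'[of Q] id[of Q] Q z(2) by blast
    qed (use zP in blast)
    moreover have "z \<oplus> w \<in> I"
      using additive_subgroup.a_closed[OF ideal.axioms(1)[OF I] z(1) w(1)] .
    ultimately show ?thesis using zP by blast
  qed
qed

end

context module
begin

text \<open>Dividing M / \<open>N\<close> by \<open>x\<close> is dividing M by this submodule, so
  iterated quotients are still described by submodules of M.\<close>

definition plus_multiples :: "'c set \<Rightarrow> 'a \<Rightarrow> 'c set" where
  "plus_multiples N x = N <+>\<^bsub>M\<^esub> multiples x (carrier M)"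

definition regular_mod :: "'c set \<Rightarrow> 'a \<Rightarrow> bool" where
  "regular_mod N x \<longleftrightarrow> (\<forall>u\<in>carrier M. x \<odot>\<^bsub>M\<^esub> u \<in> N \<longrightarrow> u \<in> N)"

lemma regular_modD: "regular_mod N x \<Longrightarrow> u \<in> carrier M \<Longrightarrow> x \<odot>\<^bsub>M\<^esub> u \<in> N \<Longrightarrow> u \<in> N"
  unfolding regular_mod_def by blast

lemma submodule_plus_multiples:
  "submodule N R M \<Longrightarrow> x \<in> carrier R \<Longrightarrow> submodule (plus_multiples N x) R M"
  unfolding plus_multiples_def by (intro submodule_set_add submodule_multiples carrier_is_submodule)

lemma plus_multiples_upper: "submodule N R M \<Longrightarrow> x \<in> carrier R \<Longrightarrow> N \<subseteq> plus_multiples N x"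
  unfolding plus_multiples_def
  by (intro set_add_upper submodule_multiples carrier_is_submodule)

lemma smult_mem_plus_multiples:
  assumes "submodule N R M" "x \<in> carrier R" "u \<in> carrier M"
  shows "x \<odot>\<^bsub>M\<^esub> u \<in> plus_multiples N x"
  using set_add_upper(2)[OF assms(1) submodule_multiples[OF carrier_is_submodule assms(2)]] assms(3)
  unfolding plus_multiples_def multiples_def by blast

lemma plus_multiples_least:
  "submodule L R M \<Longrightarrow> N \<subseteq> L \<Longrightarrow> (\<And>u. u \<in> carrier M \<Longrightarrow> x \<odot>\<^bsub>M\<^esub> u \<in> L) \<Longrightarrow> plus_multiples N x \<subseteq> L"
  unfolding plus_multiples_def by (rule set_add_least) (auto simp: multiples_def)

lemma mem_plus_multiples_iff:
  assumes N: "submodule N R M" and x: "x \<in> carrier R" and w: "w \<in> carrier M"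
  shows "w \<in> plus_multiples N x \<longleftrightarrow> (\<exists>u\<in>carrier M. w \<ominus>\<^bsub>M\<^esub> x \<odot>\<^bsub>M\<^esub> u \<in> N)"
proof
  assume "w \<in> plus_multiples N x"
  then obtain n u where nu: "n \<in> N" "u \<in> carrier M" "w = n \<oplus>\<^bsub>M\<^esub> x \<odot>\<^bsub>M\<^esub> u"
    unfolding plus_multiples_def mem_add_multiples_iff by blast
  have "w \<ominus>\<^bsub>M\<^esub> x \<odot>\<^bsub>M\<^esub> u = n"
    using nu submodule_carrier[OF N nu(1)] x by (simp add: add_diff_cancel)
  then show "\<exists>u\<in>carrier M. w \<ominus>\<^bsub>M\<^esub> x \<odot>\<^bsub>M\<^esub> u \<in> N" using nu by blast
next
  assume "\<exists>u\<in>carrier M. w \<ominus>\<^bsub>M\<^esub> x \<odot>\<^bsub>M\<^esub> u \<in> N"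
  then obtain u where u: "u \<in> carrier M" "w \<ominus>\<^bsub>M\<^esub> x \<odot>\<^bsub>M\<^esub> u \<in> N" by blast
  then have "w = (w \<ominus>\<^bsub>M\<^esub> x \<odot>\<^bsub>M\<^esub> u) \<oplus>\<^bsub>M\<^esub> x \<odot>\<^bsub>M\<^esub> u" using w x by (simp add: add_diff_cancel)
  then show "w \<in> plus_multiples N x" unfolding plus_multiples_def mem_add_multiples_iff using u by blast
qed

lemma plus_multiples_commute:
  assumes N: "submodule N R M" and x: "x \<in> carrier R" and y: "y \<in> carrier R"
  shows "plus_multiples (plus_multiples N x) y = plus_multiples (plus_multiples N y) x"
proof -
  have "plus_multiples (plus_multiples N x) y \<subseteq> plus_multiples (plus_multiples N y) x"
    if x: "x \<in> carrier R" and y: "y \<in> carrier R" for x y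
  proof -
    have Ny: "submodule (plus_multiples N y) R M" using submodule_plus_multiples N y by blast
    have Nyx: "submodule (plus_multiples (plus_multiples N y) x) R M" using submodule_plus_multiples Ny x by blast
    have "plus_multiples N x \<subseteq> plus_multiples (plus_multiples N y) x"
      using plus_multiples_least[OF Nyx] plus_multiples_upper[OF N y] plus_multiples_upper[OF Ny x]
        smult_mem_plus_multiples[OF Ny x] by blast
    then show ?thesis
      using plus_multiples_least[OF Nyx] plus_multiples_upper[OF Ny x] smult_mem_plus_multiples[OF N y] by blast
  qed
  then show ?thesis using x y by blast
qed

lemma diff_add_diff_cancel:
  assumes "p \<in> carrier M" "q \<in> carrier M" "r \<in> carrier M"
  shows "(p \<ominus>\<^bsub>M\<^esub> q) \<oplus>\<^bsub>M\<^esub> (q \<ominus>\<^bsub>M\<^esub> r) = p \<ominus>\<^bsub>M\<^esub> r"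
  using assms by (simp add: M.minus_eq M.a_assoc M.r_neg1)

lemma diff_diff_cancel:
  assumes "r \<in> carrier M" "p \<in> carrier M" "q \<in> carrier M"
  shows "(r \<ominus>\<^bsub>M\<^esub> q) \<ominus>\<^bsub>M\<^esub> (r \<ominus>\<^bsub>M\<^esub> p) = p \<ominus>\<^bsub>M\<^esub> q"
proof -
  have "\<ominus>\<^bsub>M\<^esub> (r \<ominus>\<^bsub>M\<^esub> p) = p \<ominus>\<^bsub>M\<^esub> r"
    using assms by (simp add: M.minus_eq M.minus_add M.a_comm)
  then have "(r \<ominus>\<^bsub>M\<^esub> q) \<ominus>\<^bsub>M\<^esub> (r \<ominus>\<^bsub>M\<^esub> p) = (p \<ominus>\<^bsub>M\<^esub> r) \<oplus>\<^bsub>M\<^esub> (r \<ominus>\<^bsub>M\<^esub> q)"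
    using assms by (simp add: M.minus_eq[of "r \<ominus>\<^bsub>M\<^esub> q"] M.a_comm)
  then show ?thesis using diff_add_diff_cancel assms by simp
qed

lemma diff_mem_iff:
  assumes N: "submodule N R M" and "n \<in> N" "w \<in> carrier M"
  shows "w \<ominus>\<^bsub>M\<^esub> n \<in> N \<longleftrightarrow> w \<in> N"
proof -
  have n: "n \<in> carrier M" using submodule_carrier[OF N] assms by blast
  have "n \<oplus>\<^bsub>M\<^esub> (w \<ominus>\<^bsub>M\<^esub> n) = w" using add_diff_cancel assms n by blast
  then show ?thesis using add_mem_iff[OF N assms(2), of "w \<ominus>\<^bsub>M\<^esub> n"] assms n by simp
qed

end

context local_noetherian_module
begin

lemma max_ideal_carrier: "x \<in> max_ideal R \<Longrightarrow> x \<in> carrier R"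
  using ideal.Icarr[OF primeideal.axioms(1)[OF primeideal_max_ideal]] .

lemma ex_associated_prime_local:
  assumes N: "submodule N R M" and u: "u \<in> carrier M" "u \<notin> N"
  obtains r where "r \<in> carrier R" "primeideal (colon N (r \<odot>\<^bsub>M\<^esub> u)) R"
proof -
  have "colon N u \<subseteq> max_ideal R"
    using proper_ideal_subset_max_ideal[OF ideal_colon[OF N u(1)]] one_in_colon_iff u by blast
  then show ?thesis using ex_associated_prime[OF N u(1) primeideal_max_ideal] that by blast
qed

lemma zero_divisor_in_associated_prime:
  assumes N: "submodule N R M" and x: "x \<in> carrier R" and "\<not> regular_mod N x"
  obtains w where "w \<in> carrier M" "primeideal (colon N w) R" "x \<in> colon N w"
proof -
  obtain u where u: "u \<in> carrier M" "u \<notin> N" "x \<odot>\<^bsub>M\<^esub> u \<in> N"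
    using assms(3) unfolding regular_mod_def by blast
  obtain r where r: "r \<in> carrier R" "primeideal (colon N (r \<odot>\<^bsub>M\<^esub> u)) R"
    using ex_associated_prime_local[OF N u(1,2)] by blast
  have "x \<odot>\<^bsub>M\<^esub> (r \<odot>\<^bsub>M\<^esub> u) \<in> N"
    using submoduleE(4)[OF N r(1) u(3)] smult_left_commute[OF x r(1) u(1)] by simp
  then show ?thesis using that[of "r \<odot>\<^bsub>M\<^esub> u"] r x u by (simp add: colon_def)
qed

lemma plus_multiples_neq_carrier:
  assumes N: "submodule N R M" "N \<noteq> carrier M" and x: "x \<in> max_ideal R"
  shows "plus_multiples N x \<noteq> carrier M"
proof
  assume "plus_multiples N x = carrier M"
  then have "carrier M \<subseteq> N"
    using nakayama_local[OF x N(1) carrier_is_submodule] unfolding plus_multiples_def by simp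
  then show False using N submoduleE(1) by blast
qed

text \<open>Depth of M / \<open>N\<close> at least \<open>n\<close>, with the recursion on the first
  element of a regular sequence; independence of that first element can then be proved by induction
  on \<open>n\<close>.\<close>

primrec depth_ge :: "nat \<Rightarrow> 'c set \<Rightarrow> bool" where
  "depth_ge 0 N \<longleftrightarrow> N \<noteq> carrier M"
| "depth_ge (Suc n) N \<longleftrightarrow> (\<exists>x\<in>max_ideal R. regular_mod N x \<and> depth_ge n (plus_multiples N x))"

lemma depth_ge_neq_carrier:
  "submodule N R M \<Longrightarrow> depth_ge n N \<Longrightarrow> N \<noteq> carrier M"
proof (induction n arbitrary: N)
  case (Suc n)
  then obtain x where x: "x \<in> max_ideal R" "depth_ge n (plus_multiples N x)" by auto
  have xc: "x \<in> carrier R" using max_ideal_carrier x by blast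
  have E: "submodule (plus_multiples N x) R M" using submodule_plus_multiples[OF Suc.prems(1) xc] .
  then have "plus_multiples N x \<noteq> carrier M" using Suc.IH x by blast
  then show ?case using plus_multiples_upper[OF Suc.prems(1) xc] submoduleE(1)[OF E] by blast
qed simp

text \<open>The submodule of \<open>M / N\<close> killed by an associated prime \<open>P\<close> is not contained in \<open>x M / N\<close> by
  Nakayama, so \<open>M / (N + x M)\<close> has an associated prime containing \<open>P\<close> and \<open>x\<close>.\<close>

lemma associated_prime_chain:
  assumes "submodule N R M" "depth_ge n N" "w \<in> carrier M" "primeideal (colon N w) R"
  shows "\<exists>f. prime_chain R f n \<and> f 0 = colon N w"
  using assms
proof (induction n arbitrary: N w)
  case 0
  then show ?case by (intro exI[of _ "\<lambda>_. colon N w"]) (simp add: prime_chain_def)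
next
  case (Suc n)
  note N = Suc.prems(1) and w = Suc.prems(3)
  let ?P = "colon N w"
  obtain x where x: "x \<in> max_ideal R" "regular_mod N x" "depth_ge n (plus_multiples N x)"
    using Suc.prems(2) by auto
  have xc: "x \<in> carrier R" using max_ideal_carrier x by blast
  have Pc: "p \<in> carrier R" if "p \<in> ?P" for p using that by (simp add: colon_def)
  define H where "H = {u \<in> carrier M. \<forall>p\<in>?P. p \<odot>\<^bsub>M\<^esub> u \<in> N}"
  have H: "submodule H R M"
  proof (rule submoduleI')
    show "H \<subseteq> carrier M" "\<zero>\<^bsub>M\<^esub> \<in> H" unfolding H_def using submodule_zero[OF N] Pc by auto
    show "a \<oplus>\<^bsub>M\<^esub> b \<in> H" if "a \<in> H" "b \<in> H" for a b
      using that Pc submoduleE(5)[OF N] unfolding H_def by (simp add: smult_r_distr)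
    show "a \<odot>\<^bsub>M\<^esub> u \<in> H" if "a \<in> carrier R" "u \<in> H" for a u
      using that Pc submoduleE(4)[OF N that(1)] smult_left_commute[OF _ that(1)] unfolding H_def by simp
  qed
  have "w \<in> H" using w unfolding H_def by (simp add: colon_def)
  moreover have "w \<notin> N" using colon_prime_notin[OF w] Suc.prems(4) by blast
  ultimately obtain h where h: "h \<in> H" "h \<notin> N <+>\<^bsub>M\<^esub> multiples x H"
    using nakayama_local[OF x(1) N H] by blast
  have hc: "h \<in> carrier M" using h H_def by blast
  have N': "submodule (plus_multiples N x) R M" using submodule_plus_multiples[OF N xc] .
  \<comment> \<open>Regularity of \<open>x\<close> puts \<open>u\<close> back into \<open>H\<close>:
    if p kills h modulo \<open>N\<close>, it kills x u and hence u. So Nakayama for \<open>H\<close>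
    already excludes \<open>h\<close> from x M, not only from x \<open>H\<close>.\<close>
  have "h \<notin> plus_multiples N x"
  proof
    assume "h \<in> plus_multiples N x"
    then obtain n u where nu: "n \<in> N" "u \<in> carrier M" "h = n \<oplus>\<^bsub>M\<^esub> x \<odot>\<^bsub>M\<^esub> u"
      unfolding plus_multiples_def mem_add_multiples_iff by blast
    have nc: "n \<in> carrier M" using submodule_carrier[OF N nu(1)] .
    have "p \<odot>\<^bsub>M\<^esub> u \<in> N" if p: "p \<in> ?P" for p
    proof (rule regular_modD[OF x(2)])
      have pn: "p \<odot>\<^bsub>M\<^esub> n \<in> N" using submoduleE(4)[OF N Pc[OF p] nu(1)] .
      have "p \<odot>\<^bsub>M\<^esub> h = p \<odot>\<^bsub>M\<^esub> n \<oplus>\<^bsub>M\<^esub> x \<odot>\<^bsub>M\<^esub> (p \<odot>\<^bsub>M\<^esub> u)"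
        using nu nc Pc[OF p] xc smult_left_commute by (simp add: smult_r_distr)
      moreover have "p \<odot>\<^bsub>M\<^esub> h \<in> N" using h p unfolding H_def by blast
      ultimately show "x \<odot>\<^bsub>M\<^esub> (p \<odot>\<^bsub>M\<^esub> u) \<in> N"
        using add_mem_iff[OF N pn, of "x \<odot>\<^bsub>M\<^esub> (p \<odot>\<^bsub>M\<^esub> u)"] Pc[OF p] xc nu by simp
    qed (use Pc[OF p] nu in simp)
    then have "u \<in> H" using nu unfolding H_def by blast
    then show False using h nu unfolding mem_add_multiples_iff by blast
  qed
  then obtain r where r: "r \<in> carrier R" "primeideal (colon (plus_multiples N x) (r \<odot>\<^bsub>M\<^esub> h)) R"
    using ex_associated_prime_local[OF N' hc] by blast
  let ?Q = "colon (plus_multiples N x) (r \<odot>\<^bsub>M\<^esub> h)"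
  obtain f where f: "prime_chain R f n" "f 0 = ?Q"
    using Suc.IH[OF N' x(3) _ r(2)] r hc by auto
  have "?P \<subseteq> ?Q"
  proof
    fix p assume p: "p \<in> ?P"
    have "p \<odot>\<^bsub>M\<^esub> h \<in> N" using h p unfolding H_def by blast
    then have "p \<odot>\<^bsub>M\<^esub> (r \<odot>\<^bsub>M\<^esub> h) \<in> N"
      using submoduleE(4)[OF N r(1)] smult_left_commute[OF Pc[OF p] r(1) hc] by simp
    then show "p \<in> ?Q" using Pc[OF p] plus_multiples_upper[OF N xc] by (auto simp: colon_def)
  qed
  \<comment> \<open>\<open>x\<close> separates the two primes, so the chain found for the smaller
    quotient gains one step.\<close>
  moreover have "x \<in> ?Q" using smult_mem_plus_multiples[OF N xc] r hc xc by (simp add: colon_def)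
  moreover have "x \<notin> ?P" using regular_modD[OF x(2) w] \<open>w \<notin> N\<close> by (auto simp: colon_def)
  ultimately have "?P \<subset> f 0" using f by blast
  then have "prime_chain R (case_nat ?P f) (Suc n)"
    using f(1) Suc.prems(4) unfolding prime_chain_def by (auto split: nat.split)
  then show ?case by (intro exI[of _ "case_nat ?P f"]) simp
qed

text \<open>The maximal ideal is associated to neither quotient, so it is contained in none of their
  finitely many associated primes, and prime avoidance treats both sets at once.\<close>

lemma ex_common_regular:
  assumes N: "submodule N R M" "\<And>u. u \<in> carrier M \<Longrightarrow> colon N u \<noteq> max_ideal R"
    and L: "submodule L R M" "\<And>u. u \<in> carrier M \<Longrightarrow> colon L u \<noteq> max_ideal R"
  shows "\<exists>z\<in>max_ideal R. regular_mod N z \<and> regular_mod L z"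
proof -
  let ?Ass = "\<lambda>N. {P. primeideal P R \<and> (\<exists>u\<in>carrier M. P = colon N u)}"
  have "\<exists>z\<in>max_ideal R. \<forall>P\<in>?Ass N \<union> ?Ass L. z \<notin> P"
  proof (rule prime_avoidance)
    show "ideal (max_ideal R) R" using primeideal_max_ideal by (rule primeideal.axioms)
    show "finite (?Ass N \<union> ?Ass L)" using finite_associated_primes N L by blast
  next
    fix P assume P: "P \<in> ?Ass N \<union> ?Ass L"
    then show "primeideal P R" by blast
    then have "P \<subseteq> max_ideal R" by (rule primeideal_subset_max_ideal)
    moreover have "P \<noteq> max_ideal R" using P N(2) L(2) by blast
    ultimately show "\<not> max_ideal R \<subseteq> P" by blast
  qed
  then obtain z where z: "z \<in> max_ideal R" "\<forall>P\<in>?Ass N \<union> ?Ass L. z \<notin> P" by (rule bexE)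
  have "regular_mod K z" if K: "submodule K R M" and sub: "?Ass K \<subseteq> ?Ass N \<union> ?Ass L" for K
  proof (rule ccontr)
    assume "\<not> regular_mod K z"
    then obtain w where "w \<in> carrier M" "primeideal (colon K w) R" "z \<in> colon K w"
      using zero_divisor_in_associated_prime[OF K max_ideal_carrier[OF z(1)]] by blast
    then show False using bspec[OF z(2), of "colon K w"] sub by blast
  qed
  then show ?thesis using z(1) N(1) L(1) by blast
qed

text \<open>If \<open>x\<close> and \<open>y\<close> are both regular, then the socles of \<open>M / x M\<close> and \<open>M / y M\<close> correspond to each
  other: \<open>u\<close> goes to the \<open>w\<close> with \<open>y u = x w\<close>.\<close>

lemma colon_max_ideal_exchange:
  assumes N: "submodule N R M"
    and x: "x \<in> max_ideal R" "regular_mod N x" and y: "y \<in> max_ideal R" "regular_mod N y"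
    and u: "u \<in> carrier M" "colon (plus_multiples N x) u = max_ideal R"
  shows "\<exists>w\<in>carrier M. colon (plus_multiples N y) w = max_ideal R"
proof -
  have xc: "x \<in> carrier R" and yc: "y \<in> carrier R" using max_ideal_carrier x y by auto
  have Nx: "submodule (plus_multiples N x) R M" and Ny: "submodule (plus_multiples N y) R M"
    using submodule_plus_multiples N xc yc by auto
  have "y \<odot>\<^bsub>M\<^esub> u \<in> plus_multiples N x" using y(1) u(2) by (auto simp: colon_def)
  then obtain w where w: "w \<in> carrier M" "y \<odot>\<^bsub>M\<^esub> u \<ominus>\<^bsub>M\<^esub> x \<odot>\<^bsub>M\<^esub> w \<in> N"
    using mem_plus_multiples_iff[OF N xc, of "y \<odot>\<^bsub>M\<^esub> u"] yc u by auto
  \<comment> \<open>This identity serves twice: for \<open>a\<close> in the maximal ideal it shows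
    that \<open>a\<close> kills \<open>w\<close> modulo \<open>y\<close>, and for \<open>a\<close> =
    1 that \<open>w\<close> is nonzero there.\<close>
  have id: "x \<odot>\<^bsub>M\<^esub> (a \<odot>\<^bsub>M\<^esub> w \<ominus>\<^bsub>M\<^esub> y \<odot>\<^bsub>M\<^esub> v) =
      y \<odot>\<^bsub>M\<^esub> (a \<odot>\<^bsub>M\<^esub> u \<ominus>\<^bsub>M\<^esub> x \<odot>\<^bsub>M\<^esub> v) \<ominus>\<^bsub>M\<^esub> a \<odot>\<^bsub>M\<^esub> (y \<odot>\<^bsub>M\<^esub> u \<ominus>\<^bsub>M\<^esub> x \<odot>\<^bsub>M\<^esub> w)"
    if a: "a \<in> carrier R" and v: "v \<in> carrier M" for a v
    using diff_diff_cancel[of "y \<odot>\<^bsub>M\<^esub> (a \<odot>\<^bsub>M\<^esub> u)" "x \<odot>\<^bsub>M\<^esub> (a \<odot>\<^bsub>M\<^esub> w)" "x \<odot>\<^bsub>M\<^esub> (y \<odot>\<^bsub>M\<^esub> v)"]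
      smult_left_commute[OF a yc u(1)] smult_left_commute[OF a xc w(1)] smult_left_commute[OF xc yc v]
      a v u w(1) xc yc
    by (simp add: smult_diff)
  have "max_ideal R \<subseteq> colon (plus_multiples N y) w"
  proof
    fix a assume a: "a \<in> max_ideal R"
    have ac: "a \<in> carrier R" using max_ideal_carrier a by blast
    have "a \<odot>\<^bsub>M\<^esub> u \<in> plus_multiples N x" using a u(2) by (auto simp: colon_def)
    then obtain v where v: "v \<in> carrier M" "a \<odot>\<^bsub>M\<^esub> u \<ominus>\<^bsub>M\<^esub> x \<odot>\<^bsub>M\<^esub> v \<in> N"
      using mem_plus_multiples_iff[OF N xc, of "a \<odot>\<^bsub>M\<^esub> u"] ac u by auto
    have "x \<odot>\<^bsub>M\<^esub> (a \<odot>\<^bsub>M\<^esub> w \<ominus>\<^bsub>M\<^esub> y \<odot>\<^bsub>M\<^esub> v) \<in> N"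
      unfolding id[OF ac v(1)]
      by (intro submodule_diff[OF N] submoduleE(4)[OF N] yc ac v w)
    then have "a \<odot>\<^bsub>M\<^esub> w \<ominus>\<^bsub>M\<^esub> y \<odot>\<^bsub>M\<^esub> v \<in> N"
      using regular_modD[OF x(2)] ac yc v w by simp
    then show "a \<in> colon (plus_multiples N y) w"
      using mem_plus_multiples_iff[OF N yc, of "a \<odot>\<^bsub>M\<^esub> w"] ac w v by (auto simp: colon_def)
  qed
  moreover have "\<one> \<notin> colon (plus_multiples N y) w"
  proof
    assume "\<one> \<in> colon (plus_multiples N y) w"
    then obtain v where v: "v \<in> carrier M" "w \<ominus>\<^bsub>M\<^esub> y \<odot>\<^bsub>M\<^esub> v \<in> N"
      using one_in_colon_iff[OF w(1)] mem_plus_multiples_iff[OF N yc w(1)] by blast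
    have "x \<odot>\<^bsub>M\<^esub> (w \<ominus>\<^bsub>M\<^esub> y \<odot>\<^bsub>M\<^esub> v) \<in> N" using submoduleE(4)[OF N xc v(2)] .
    then have "y \<odot>\<^bsub>M\<^esub> (u \<ominus>\<^bsub>M\<^esub> x \<odot>\<^bsub>M\<^esub> v) \<ominus>\<^bsub>M\<^esub> (y \<odot>\<^bsub>M\<^esub> u \<ominus>\<^bsub>M\<^esub> x \<odot>\<^bsub>M\<^esub> w) \<in> N"
      using id[of \<one> v] v w u xc yc by simp
    then have "y \<odot>\<^bsub>M\<^esub> (u \<ominus>\<^bsub>M\<^esub> x \<odot>\<^bsub>M\<^esub> v) \<in> N"
      using diff_mem_iff[OF N w(2), of "y \<odot>\<^bsub>M\<^esub> (u \<ominus>\<^bsub>M\<^esub> x \<odot>\<^bsub>M\<^esub> v)"] u v xc yc by simp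
    then have "u \<ominus>\<^bsub>M\<^esub> x \<odot>\<^bsub>M\<^esub> v \<in> N" using regular_modD[OF y(2)] u v xc by simp
    then have "u \<in> plus_multiples N x" using mem_plus_multiples_iff[OF N xc u(1)] v by blast
    then have "\<one> \<in> max_ideal R" using one_in_colon_iff[OF u(1)] u(2) by blast
    then show False using primeideal.one_notin[OF primeideal_max_ideal] by blast
  qed
  ultimately show ?thesis
    using proper_ideal_subset_max_ideal[OF ideal_colon[OF Ny w(1)]] w(1) by blast
qed

text \<open>From x u = z v modulo \<open>N\<close>, regularity of \<open>z\<close> modulo
  \<open>x\<close> gives v = x v', and cancelling the regular \<open>x\<close> leaves u = z
  v'.\<close>

lemma regular_mod_swap:
  assumes N: "submodule N R M" and x: "x \<in> carrier R" "regular_mod N x"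
    and z: "z \<in> carrier R" "regular_mod (plus_multiples N x) z"
  shows "regular_mod (plus_multiples N z) x"
  unfolding regular_mod_def
proof (intro ballI impI)
  fix u assume u: "u \<in> carrier M" "x \<odot>\<^bsub>M\<^esub> u \<in> plus_multiples N z"
  then obtain v where v: "v \<in> carrier M" "x \<odot>\<^bsub>M\<^esub> u \<ominus>\<^bsub>M\<^esub> z \<odot>\<^bsub>M\<^esub> v \<in> N"
    using mem_plus_multiples_iff[OF N z(1), of "x \<odot>\<^bsub>M\<^esub> u"] x by auto
  have "\<ominus>\<^bsub>M\<^esub> (x \<odot>\<^bsub>M\<^esub> u \<ominus>\<^bsub>M\<^esub> z \<odot>\<^bsub>M\<^esub> v) = z \<odot>\<^bsub>M\<^esub> v \<ominus>\<^bsub>M\<^esub> x \<odot>\<^bsub>M\<^esub> u"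
    using x z u v by (simp add: M.minus_eq M.minus_add M.a_comm)
  then have "z \<odot>\<^bsub>M\<^esub> v \<ominus>\<^bsub>M\<^esub> x \<odot>\<^bsub>M\<^esub> u \<in> N" using submoduleE(3)[OF N v(2)] by simp
  then have "z \<odot>\<^bsub>M\<^esub> v \<in> plus_multiples N x"
    using mem_plus_multiples_iff[OF N x(1), of "z \<odot>\<^bsub>M\<^esub> v"] z v u by auto
  then have "v \<in> plus_multiples N x" using regular_modD[OF z(2) v(1)] by blast
  then obtain v' where v': "v' \<in> carrier M" "v \<ominus>\<^bsub>M\<^esub> x \<odot>\<^bsub>M\<^esub> v' \<in> N"
    using mem_plus_multiples_iff[OF N x(1) v(1)] by blast
  have "x \<odot>\<^bsub>M\<^esub> (u \<ominus>\<^bsub>M\<^esub> z \<odot>\<^bsub>M\<^esub> v') =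
      (x \<odot>\<^bsub>M\<^esub> u \<ominus>\<^bsub>M\<^esub> z \<odot>\<^bsub>M\<^esub> v) \<oplus>\<^bsub>M\<^esub> z \<odot>\<^bsub>M\<^esub> (v \<ominus>\<^bsub>M\<^esub> x \<odot>\<^bsub>M\<^esub> v')"
    using diff_add_diff_cancel[of "x \<odot>\<^bsub>M\<^esub> u" "z \<odot>\<^bsub>M\<^esub> v" "z \<odot>\<^bsub>M\<^esub> (x \<odot>\<^bsub>M\<^esub> v')"]
      smult_left_commute[OF x(1) z(1) v'(1)] x(1) z(1) u(1) v(1) v'(1)
    by (simp add: smult_diff)
  also have "\<dots> \<in> N"
    by (intro submoduleE(5)[OF N] submoduleE(4)[OF N] v v' z)
  finally have "u \<ominus>\<^bsub>M\<^esub> z \<odot>\<^bsub>M\<^esub> v' \<in> N" using regular_modD[OF x(2)] u v' z by simp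
  then show "u \<in> plus_multiples N z" using mem_plus_multiples_iff[OF N z(1) u(1)] v' by blast
qed

text \<open>Depth does not depend on the first element chosen. With \<open>z\<close> regular modulo
  both \<open>x\<close> and \<open>y\<close>, the passage from \<open>x\<close> to \<open>y\<close>
  goes through the pairs (x, z), (z, x), (z, y), (y, z), by swaps and the induction
  hypothesis.\<close>

lemma depth_ge_plus_multiples:
  assumes "submodule N R M" "depth_ge (Suc n) N" "y \<in> max_ideal R" "regular_mod N y"
  shows "depth_ge n (plus_multiples N y)"
  using assms
proof (induction n arbitrary: N y)
  case 0
  then show ?case
    using plus_multiples_neq_carrier[OF 0(1) depth_ge_neq_carrier[OF 0(1,2)] 0(3)] by simp
next
  case (Suc n)
  note N = Suc.prems(1) and y = Suc.prems(3,4)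
  obtain x where x: "x \<in> max_ideal R" "regular_mod N x" "depth_ge (Suc n) (plus_multiples N x)"
    using Suc.prems(2) by (auto simp del: depth_ge.simps(2) simp: depth_ge.simps(2)[of "Suc n"])
  then obtain x' where x': "x' \<in> max_ideal R" "regular_mod (plus_multiples N x) x'" by auto
  have xc: "x \<in> carrier R" and yc: "y \<in> carrier R" using max_ideal_carrier x y by auto
  have Nx: "submodule (plus_multiples N x) R M" and Ny: "submodule (plus_multiples N y) R M"
    using submodule_plus_multiples N xc yc by auto
  \<comment> \<open>A second regular element \<open>x'\<close> excludes a socle modulo
    \<open>x\<close>; the exchange lemma carries this over to \<open>y\<close>.\<close>
  have nx: "colon (plus_multiples N x) u \<noteq> max_ideal R" if u: "u \<in> carrier M" for u
  proof
    assume eq: "colon (plus_multiples N x) u = max_ideal R"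
    then have "x' \<odot>\<^bsub>M\<^esub> u \<in> plus_multiples N x" using x'(1) by (auto simp: colon_def)
    then have "\<one> \<in> max_ideal R"
      using regular_modD[OF x'(2) u] one_in_colon_iff[OF u] eq by blast
    then show False using primeideal.one_notin[OF primeideal_max_ideal] by blast
  qed
  have ny: "colon (plus_multiples N y) u \<noteq> max_ideal R" if u: "u \<in> carrier M" for u
    using colon_max_ideal_exchange[OF N y x(1,2) u] nx by blast
  obtain z where z: "z \<in> max_ideal R" "regular_mod (plus_multiples N x) z" "regular_mod (plus_multiples N y) z"
    using ex_common_regular[OF Nx nx Ny ny] by blast
  have zc: "z \<in> carrier R" using max_ideal_carrier z by blast
  have Nz: "submodule (plus_multiples N z) R M" using submodule_plus_multiples N zc by blast
  \<comment> \<open>The induction hypothesis is used here modulo \<open>x\<close> with the new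
    element \<open>z\<close>, and once more below modulo \<open>z\<close> with the new element
    \<open>y\<close>.\<close>
  have "depth_ge n (plus_multiples (plus_multiples N x) z)" using Suc.IH[OF Nx x(3) z(1,2)] .
  then have "depth_ge n (plus_multiples (plus_multiples N z) x)" using plus_multiples_commute[OF N xc zc] by simp
  moreover have "regular_mod (plus_multiples N z) x" using regular_mod_swap[OF N xc x(2) zc z(2)] .
  ultimately have "depth_ge (Suc n) (plus_multiples N z)" using x(1) by auto
  moreover have "regular_mod (plus_multiples N z) y" using regular_mod_swap[OF N yc y(2) zc z(3)] .
  ultimately have "depth_ge n (plus_multiples (plus_multiples N z) y)" using Suc.IH[OF Nz _ y(1)] by blast
  then have "depth_ge n (plus_multiples (plus_multiples N y) z)" using plus_multiples_commute[OF N yc zc] by simp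
  then show ?case using z by auto
qed

text \<open>If an element killed by a power of \<open>x\<close> survived modulo \<open>x\<close>,
  the depth hypothesis would give a chain of length \<open>k\<close> above an associated prime of
  the smaller quotient. Below that prime there is an associated prime of M / \<open>N\<close>
  containing a power of \<open>x\<close>, hence \<open>x\<close>, and it starts a forbidden
  chain.\<close>

lemma regular_mod_if_no_long_chains:
  assumes N: "submodule N R M" and x: "x \<in> max_ideal R" and depth: "depth_ge k (plus_multiples N x)"
    and short: "\<And>w f. \<lbrakk>w \<in> carrier M; primeideal (colon N w) R; x \<in> colon N w;
      prime_chain R f k; f 0 = colon N w\<rbrakk> \<Longrightarrow> False"
  shows "regular_mod N x"
proof -
  have xc: "x \<in> carrier R" using max_ideal_carrier x by blast
  have E: "submodule (plus_multiples N x) R M" using submodule_plus_multiples[OF N xc] .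
  define T where "T n = {u \<in> carrier M. (x [^] (n::nat)) \<odot>\<^bsub>M\<^esub> u \<in> N}" for n
  have T: "submodule (T n) R M" for n
  proof (rule submoduleI')
    show "T n \<subseteq> carrier M" "\<zero>\<^bsub>M\<^esub> \<in> T n" unfolding T_def using submodule_zero[OF N] xc by auto
    show "a \<oplus>\<^bsub>M\<^esub> b \<in> T n" if "a \<in> T n" "b \<in> T n" for a b
      using that xc submoduleE(5)[OF N] unfolding T_def by (simp add: smult_r_distr)
    show "a \<odot>\<^bsub>M\<^esub> u \<in> T n" if "a \<in> carrier R" "u \<in> T n" for a u
      using that xc submoduleE(4)[OF N] smult_left_commute unfolding T_def by simp
  qed
  have pow: "(x [^] Suc n) \<odot>\<^bsub>M\<^esub> u = (x [^] n) \<odot>\<^bsub>M\<^esub> (x \<odot>\<^bsub>M\<^esub> u)" if "u \<in> carrier M" for n u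
    using that xc by (simp add: smult_assoc1)
  have T_mono: "T n \<subseteq> T (Suc n)" for n
  proof
    fix u assume u: "u \<in> T n"
    then have "(x [^] Suc n) \<odot>\<^bsub>M\<^esub> u = x \<odot>\<^bsub>M\<^esub> ((x [^] n) \<odot>\<^bsub>M\<^esub> u)"
      using smult_left_commute[of "x [^] n" x u] pow[of u n] xc unfolding T_def by auto
    then show "u \<in> T (Suc n)"
      using u submoduleE(4)[OF N xc, of "(x [^] n) \<odot>\<^bsub>M\<^esub> u"] unfolding T_def by auto
  qed
  have T_plus_multiples: "T n \<subseteq> plus_multiples N x" for n
  proof (rule ccontr)
    assume "\<not> T n \<subseteq> plus_multiples N x"
    then obtain u where u: "u \<in> carrier M" "(x [^] n) \<odot>\<^bsub>M\<^esub> u \<in> N" "u \<notin> plus_multiples N x"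
      unfolding T_def by blast
    obtain r where r: "r \<in> carrier R" "primeideal (colon (plus_multiples N x) (r \<odot>\<^bsub>M\<^esub> u)) R"
      using ex_associated_prime_local[OF E u(1,3)] by blast
    let ?v = "r \<odot>\<^bsub>M\<^esub> u"
    have v: "?v \<in> carrier M" using r u by simp
    obtain f where f: "prime_chain R f k" "f 0 = colon (plus_multiples N x) ?v"
      using associated_prime_chain[OF E depth v r(2)] by blast
    obtain s where s: "s \<in> carrier R" "primeideal (colon N (s \<odot>\<^bsub>M\<^esub> ?v)) R"
      "colon N (s \<odot>\<^bsub>M\<^esub> ?v) \<subseteq> colon (plus_multiples N x) ?v"
      using ex_associated_prime[OF N v r(2) colon_mono[OF plus_multiples_upper[OF N xc]]] by blast
    let ?Q = "colon N (s \<odot>\<^bsub>M\<^esub> ?v)"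
    have "(x [^] n) \<odot>\<^bsub>M\<^esub> (s \<odot>\<^bsub>M\<^esub> ?v) = s \<odot>\<^bsub>M\<^esub> (r \<odot>\<^bsub>M\<^esub> ((x [^] n) \<odot>\<^bsub>M\<^esub> u))"
      using s r u xc smult_left_commute by simp
    then have "x [^] n \<in> ?Q"
      using submoduleE(4)[OF N] s r u xc by (simp add: colon_def)
    then have xQ: "x \<in> ?Q"
    proof (induction n)
      case 0
      then show ?case using primeideal.one_notin[OF s(2)] by simp
    next
      case (Suc n)
      then show ?case using primeideal.I_prime[OF s(2), of "x [^] n" x] xc by auto
    qed
    have "prime_chain R (f(0 := ?Q)) k"
      using prime_chain_upd_0[OF f(1) s(2)] f(2) s(3) by simp
    then show False using short[OF _ s(2) xQ, of "f(0 := ?Q)"] s v by simp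
  qed
  \<comment> \<open>The growing torsion submodules become stationary. For u = a + x v in
    \<open>T n\<close> with a in \<open>N\<close>, the element v is in \<open>T (Suc n)\<close>,
    hence in \<open>T n\<close>; this is the form in which Nakayama applies.\<close>
  have "\<exists>L\<in>range T. \<forall>L'\<in>range T. L \<subseteq> L' \<longrightarrow> L' = L"
    by (rule ex_maximal_submodule) (use T in auto)
  then obtain n where "\<And>L'. L' \<in> range T \<Longrightarrow> T n \<subseteq> L' \<Longrightarrow> L' = T n" by (metis rangeE)
  then have n: "T (Suc n) = T n" using T_mono by simp
  have "T n \<subseteq> N <+>\<^bsub>M\<^esub> multiples x (T n)"
  proof
    fix u assume u: "u \<in> T n"
    then have uc: "u \<in> carrier M" "(x [^] n) \<odot>\<^bsub>M\<^esub> u \<in> N" unfolding T_def by auto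
    obtain a v where av: "a \<in> N" "v \<in> carrier M" "u = a \<oplus>\<^bsub>M\<^esub> x \<odot>\<^bsub>M\<^esub> v"
      using T_plus_multiples[of n] u unfolding plus_multiples_def mem_add_multiples_iff subset_iff by blast
    have ac: "a \<in> carrier M" using submodule_carrier[OF N av(1)] .
    have "(x [^] n) \<odot>\<^bsub>M\<^esub> u = (x [^] n) \<odot>\<^bsub>M\<^esub> a \<oplus>\<^bsub>M\<^esub> (x [^] Suc n) \<odot>\<^bsub>M\<^esub> v"
      using av ac xc by (simp add: smult_r_distr smult_assoc1)
    moreover have "(x [^] n) \<odot>\<^bsub>M\<^esub> a \<in> N" using submoduleE(4)[OF N] av xc by simp
    ultimately have "(x [^] Suc n) \<odot>\<^bsub>M\<^esub> v \<in> N"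
      using add_mem_iff[OF N, of "(x [^] n) \<odot>\<^bsub>M\<^esub> a" "(x [^] Suc n) \<odot>\<^bsub>M\<^esub> v"] uc av xc
      by simp
    then have "v \<in> T (Suc n)" using av unfolding T_def by blast
    then have "v \<in> T n" using n by simp
    then show "u \<in> N <+>\<^bsub>M\<^esub> multiples x (T n)" unfolding mem_add_multiples_iff using av by blast
  qed
  then have TN: "T n \<subseteq> N" by (rule nakayama_local[OF x N T])
  show ?thesis
    unfolding regular_mod_def
  proof (intro ballI impI)
    fix u assume u: "u \<in> carrier M" "x \<odot>\<^bsub>M\<^esub> u \<in> N"
    then have "(x [^] n) \<odot>\<^bsub>M\<^esub> (x \<odot>\<^bsub>M\<^esub> u) \<in> N" using submoduleE(4)[OF N] xc by simp
    then have "u \<in> T (Suc n)" using u pow[OF u(1)] unfolding T_def by simp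
    then show "u \<in> N" using n TN by blast
  qed
qed

end

section \<open>Quotient modules and systems of parameters\<close>

context cring
begin

lemma carrier_quot: "carrier (R Quot I) = (+>) I ` carrier R"
  unfolding FactRing_def A_RCOSETS_def' by auto

lemma zero_quot: "\<zero>\<^bsub>R Quot I\<^esub> = I"
  by (simp add: FactRing_def)

lemma primeideal_quot_image:
  assumes I: "ideal I R" and P: "primeideal P R" "I \<subseteq> P"
  shows "primeideal ((+>) I ` P) (R Quot I)"
proof -
  have mem: "a \<in> P" if a: "a \<in> carrier R" "I +> a \<in> (+>) I ` P" for a
  proof -
    obtain p where p: "p \<in> P" "I +> a = I +> p" using a by blast
    have id: "ideal P R" using P(1) by (rule primeideal.axioms)
    have "a \<ominus> p \<in> I"
      using quotient_eq_iff_same_a_r_cos[OF I a(1)] p ideal.Icarr[OF id p(1)] by simp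
    then show ?thesis using ideal.diff_cancel[OF id a(1) p(1)] P(2) by blast
  qed
  note carr = carrier_quot[of I]
  show ?thesis
  proof (rule primeidealI)
    show "ideal ((+>) I ` P) (R Quot I)"
      using ring_ideal_imp_quot_ideal[OF I] P(1) primeideal.axioms(1) by blast
    show "cring (R Quot I)" using ideal.quotient_is_cring[OF I is_cring] .
    have "I +> \<one> \<in> carrier (R Quot I)" unfolding carr by blast
    then show "carrier (R Quot I) \<noteq> (+>) I ` P"
      using mem[of \<one>] primeideal.one_notin[OF P(1)] by auto
  next
    fix A B
    assume AB: "A \<in> carrier (R Quot I)" "B \<in> carrier (R Quot I)"
      "A \<otimes>\<^bsub>R Quot I\<^esub> B \<in> (+>) I ` P"
    obtain a b where ab: "a \<in> carrier R" "b \<in> carrier R" "A = I +> a" "B = I +> b"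
      using AB(1,2) unfolding carr by blast
    have "I +> (a \<otimes> b) \<in> (+>) I ` P"
      using AB(3) ideal.rcoset_mult_add[OF I ab(1,2)] ab by (simp add: FactRing_def)
    then have "a \<otimes> b \<in> P" using mem ab by simp
    then show "A \<in> (+>) I ` P \<or> B \<in> (+>) I ` P"
      using primeideal.I_prime[OF P(1) ab(1,2)] ab by blast
  qed
qed

lemma le_krull_dim_quot:
  assumes I: "ideal I R" and f: "prime_chain R f n" "I \<subseteq> f 0"
  shows "enat n \<le> krull_dim (R Quot I)"
proof -
  have prime: "primeideal (f i) R" if "i \<le> n" for i using f that unfolding prime_chain_def by blast
  have sub: "I \<subseteq> f i" if "i \<le> n" for i using f(2) prime_chain_mono[OF f(1), of 0 i] that by blast
  have "(+>) I ` f i \<subset> (+>) I ` f (Suc i)" if i: "i < n" for i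
  proof -
    have "f i \<subset> f (Suc i)" using f i unfolding prime_chain_def by blast
    then obtain a where a: "a \<in> f (Suc i)" "a \<notin> f i" by blast
    have id: "ideal (f i) R" "ideal (f (Suc i)) R"
      using prime[of i] prime[of "Suc i"] i primeideal.axioms(1) by auto
    have ac: "a \<in> carrier R" using ideal.Icarr[OF id(2) a(1)] .
    have "I +> a \<notin> (+>) I ` f i"
    proof
      assume "I +> a \<in> (+>) I ` f i"
      then obtain p where p: "p \<in> f i" "I +> a = I +> p" by blast
      have "a \<ominus> p \<in> I"
        using quotient_eq_iff_same_a_r_cos[OF I ac] p ideal.Icarr[OF id(1) p(1)] by simp
      then show False using ideal.diff_cancel[OF id(1) ac p(1)] sub[of i] i a by auto
    qed
    then show ?thesis using a \<open>f i \<subset> f (Suc i)\<close> by blast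
  qed
  then have "(\<forall>i\<le>n. primeideal ((+>) I ` f i) (R Quot I)) \<and>
      (\<forall>i<n. (+>) I ` f i \<subset> (+>) I ` f (Suc i))"
    using primeideal_quot_image[OF I prime sub] by blast
  then show ?thesis
    unfolding krull_dim_def
    by (intro Sup_upper CollectI exI[of _ n] conjI[OF refl] exI[of _ "\<lambda>i. (+>) I ` f i"])
qed

lemma krull_dim_quot_le:
  assumes I: "ideal I R" and le: "\<And>f n. prime_chain R f n \<Longrightarrow> I \<subseteq> f 0 \<Longrightarrow> n \<le> r"
  shows "krull_dim (R Quot I) \<le> enat r"
  unfolding krull_dim_def
proof (rule Sup_least)
  interpret h: ring_hom_ring R "R Quot I" "(+>) I" by (rule ideal.rcos_ring_hom_ring[OF I])
  fix k assume "k \<in> {enat n |n. \<exists>P. (\<forall>i\<le>n. primeideal (P i) (R Quot I)) \<and> (\<forall>i<n. P i \<subset> P (Suc i))}"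
  then obtain n P where k: "k = enat n" and P: "\<And>i. i \<le> n \<Longrightarrow> primeideal (P i) (R Quot I)"
    "\<And>i. i < n \<Longrightarrow> P i \<subset> P (Suc i)" by blast
  define f where "f i = {r \<in> carrier R. I +> r \<in> P i}" for i
  have "prime_chain R f n"
    unfolding prime_chain_def
  proof (intro conjI allI impI)
    show "primeideal (f i) R" if "i \<le> n" for i
      unfolding f_def by (rule h.primeideal_vimage[OF is_cring P(1)[OF that]])
    show "f i \<subset> f (Suc i)" if i: "i < n" for i
    proof -
      obtain A where A: "A \<in> P (Suc i)" "A \<notin> P i" using P(2)[OF i] by blast
      have "A \<in> carrier (R Quot I)"
        using ideal.Icarr[OF primeideal.axioms(1)[OF P(1)[of "Suc i"]] A(1)] i by simp
      then obtain a where "a \<in> carrier R" "A = I +> a"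
        unfolding carrier_quot by blast
      then show ?thesis using A P(2)[OF i] unfolding f_def by blast
    qed
  qed
  moreover have "I \<subseteq> f 0"
  proof
    fix a assume a: "a \<in> I"
    have ac: "a \<in> carrier R" using ideal.Icarr[OF I a] .
    have "I +> a = \<zero>\<^bsub>R Quot I\<^esub>"
      unfolding zero_quot using I a by (rule a_rcos_zero)
    then show "a \<in> f 0"
      unfolding f_def
      using ac additive_subgroup.zero_closed[OF ideal.axioms(1)[OF primeideal.axioms(1)[OF P(1)[of 0]]]]
      by simp
  qed
  ultimately show "k \<le> enat r" using le k by simp
qed

end

section \<open>Quotient modules translated into submodules of \<open>M\<close>\<close>

context module
begin

lemma mem_coset_iff:
  assumes N: "submodule N R M" and u: "u \<in> carrier M"
  shows "w \<in> N +>\<^bsub>M\<^esub> u \<longleftrightarrow> w \<in> carrier M \<and> w \<ominus>\<^bsub>M\<^esub> u \<in> N"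
proof
  assume "w \<in> N +>\<^bsub>M\<^esub> u"
  then obtain n where n: "n \<in> N" "w = n \<oplus>\<^bsub>M\<^esub> u" by (auto simp: a_r_coset_def')
  then show "w \<in> carrier M \<and> w \<ominus>\<^bsub>M\<^esub> u \<in> N"
    using submodule_carrier[OF N n(1)] u by (simp add: add_diff_cancel)
next
  assume w: "w \<in> carrier M \<and> w \<ominus>\<^bsub>M\<^esub> u \<in> N"
  then have "w = (w \<ominus>\<^bsub>M\<^esub> u) \<oplus>\<^bsub>M\<^esub> u" using u by (simp add: add_diff_cancel)
  then show "w \<in> N +>\<^bsub>M\<^esub> u" using w by (auto simp: a_r_coset_def')
qed

lemma coset_eq_iff:
  assumes N: "submodule N R M" and uv: "u \<in> carrier M" "v \<in> carrier M"
  shows "N +>\<^bsub>M\<^esub> u = N +>\<^bsub>M\<^esub> v \<longleftrightarrow> u \<ominus>\<^bsub>M\<^esub> v \<in> N"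
proof
  assume "N +>\<^bsub>M\<^esub> u = N +>\<^bsub>M\<^esub> v"
  moreover have "u \<in> N +>\<^bsub>M\<^esub> u"
    using mem_coset_iff[OF N uv(1)] uv submodule_zero[OF N] by (simp add: M.minus_eq M.r_neg)
  ultimately show "u \<ominus>\<^bsub>M\<^esub> v \<in> N" using mem_coset_iff[OF N uv(2)] by blast
next
  have *: "N +>\<^bsub>M\<^esub> u \<subseteq> N +>\<^bsub>M\<^esub> v" if "u \<ominus>\<^bsub>M\<^esub> v \<in> N" "u \<in> carrier M" "v \<in> carrier M" for u v
  proof
    fix w assume "w \<in> N +>\<^bsub>M\<^esub> u"
    then have w: "w \<in> carrier M" "w \<ominus>\<^bsub>M\<^esub> u \<in> N" using mem_coset_iff[OF N that(2)] by auto
    have "w \<ominus>\<^bsub>M\<^esub> v = (w \<ominus>\<^bsub>M\<^esub> u) \<oplus>\<^bsub>M\<^esub> (u \<ominus>\<^bsub>M\<^esub> v)"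
      using w that by (simp add: diff_add_diff_cancel)
    then show "w \<in> N +>\<^bsub>M\<^esub> v"
      using mem_coset_iff[OF N that(3)] submoduleE(5)[OF N w(2) that(1)] w by simp
  qed
  assume uvN: "u \<ominus>\<^bsub>M\<^esub> v \<in> N"
  have "v \<ominus>\<^bsub>M\<^esub> u = \<ominus>\<^bsub>M\<^esub> (u \<ominus>\<^bsub>M\<^esub> v)"
    using uv by (simp add: M.minus_eq M.minus_add M.a_comm)
  then have "v \<ominus>\<^bsub>M\<^esub> u \<in> N" using submoduleE(3)[OF N uvN] by simp
  then show "N +>\<^bsub>M\<^esub> u = N +>\<^bsub>M\<^esub> v" using *[OF uvN] * uv by blast
qed

lemma coset_zero: "submodule N R M \<Longrightarrow> N +>\<^bsub>M\<^esub> \<zero>\<^bsub>M\<^esub> = N"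
  using submodule_carrier[of N] by (auto simp: a_r_coset_def' M.minus_eq)

lemma coset_eq_zero_iff:
  assumes "submodule N R M" "u \<in> carrier M" shows "N +>\<^bsub>M\<^esub> u = N \<longleftrightarrow> u \<in> N"
  using coset_eq_iff[OF assms, of "\<zero>\<^bsub>M\<^esub>"] coset_zero[OF assms(1)]
    diff_mem_iff[OF assms(1) submodule_zero[OF assms(1)] assms(2)] by simp

lemma carrier_FactModule: "carrier (FactModule M N) = (\<lambda>u. N +>\<^bsub>M\<^esub> u) ` carrier M"
  by (auto simp: FactModule_def A_RCOSETS_def')

lemma zero_FactModule: "\<zero>\<^bsub>FactModule M N\<^esub> = N"
  by (simp add: FactModule_def)

lemma add_FactModule:
  assumes N: "submodule N R M" and uv: "u \<in> carrier M" "v \<in> carrier M"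
  shows "(N +>\<^bsub>M\<^esub> u) \<oplus>\<^bsub>FactModule M N\<^esub> (N +>\<^bsub>M\<^esub> v) = N +>\<^bsub>M\<^esub> (u \<oplus>\<^bsub>M\<^esub> v)"
proof -
  have "w \<in> (N +>\<^bsub>M\<^esub> u) <+>\<^bsub>M\<^esub> (N +>\<^bsub>M\<^esub> v) \<longleftrightarrow> w \<in> N +>\<^bsub>M\<^esub> (u \<oplus>\<^bsub>M\<^esub> v)" for w
  proof
    assume "w \<in> (N +>\<^bsub>M\<^esub> u) <+>\<^bsub>M\<^esub> (N +>\<^bsub>M\<^esub> v)"
    then obtain n l where nl: "n \<in> N" "l \<in> N" "w = (n \<oplus>\<^bsub>M\<^esub> u) \<oplus>\<^bsub>M\<^esub> (l \<oplus>\<^bsub>M\<^esub> v)"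
      unfolding mem_set_add_iff by (auto simp: a_r_coset_def')
    then have "w = (n \<oplus>\<^bsub>M\<^esub> l) \<oplus>\<^bsub>M\<^esub> (u \<oplus>\<^bsub>M\<^esub> v)"
      using uv submodule_carrier[OF N] by (simp add: M.a_ac)
    then show "w \<in> N +>\<^bsub>M\<^esub> (u \<oplus>\<^bsub>M\<^esub> v)"
      using submoduleE(5)[OF N nl(1,2)] by (auto simp: a_r_coset_def')
  next
    assume "w \<in> N +>\<^bsub>M\<^esub> (u \<oplus>\<^bsub>M\<^esub> v)"
    then obtain n where n: "n \<in> N" "w = n \<oplus>\<^bsub>M\<^esub> (u \<oplus>\<^bsub>M\<^esub> v)" by (auto simp: a_r_coset_def')
    then have "w = (n \<oplus>\<^bsub>M\<^esub> u) \<oplus>\<^bsub>M\<^esub> (\<zero>\<^bsub>M\<^esub> \<oplus>\<^bsub>M\<^esub> v)"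
      using uv submodule_carrier[OF N] by (simp add: M.a_ac)
    moreover have "n \<oplus>\<^bsub>M\<^esub> u \<in> N +>\<^bsub>M\<^esub> u" "\<zero>\<^bsub>M\<^esub> \<oplus>\<^bsub>M\<^esub> v \<in> N +>\<^bsub>M\<^esub> v"
      using n submodule_zero[OF N] unfolding a_r_coset_def' by blast+
    ultimately show "w \<in> (N +>\<^bsub>M\<^esub> u) <+>\<^bsub>M\<^esub> (N +>\<^bsub>M\<^esub> v)" unfolding mem_set_add_iff by blast
  qed
  then show ?thesis by (auto simp: FactModule_def)
qed

lemma smult_FactModule:
  assumes N: "submodule N R M" and a: "a \<in> carrier R" and u: "u \<in> carrier M"
  shows "a \<odot>\<^bsub>FactModule M N\<^esub> (N +>\<^bsub>M\<^esub> u) = N +>\<^bsub>M\<^esub> (a \<odot>\<^bsub>M\<^esub> u)"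
proof -
  have "N +>\<^bsub>M\<^esub> (a \<odot>\<^bsub>M\<^esub> v) = N +>\<^bsub>M\<^esub> (a \<odot>\<^bsub>M\<^esub> u)" if v: "v \<in> N +>\<^bsub>M\<^esub> u" for v
  proof -
    have v: "v \<in> carrier M" "v \<ominus>\<^bsub>M\<^esub> u \<in> N" using v mem_coset_iff[OF N u] by auto
    then have "a \<odot>\<^bsub>M\<^esub> v \<ominus>\<^bsub>M\<^esub> a \<odot>\<^bsub>M\<^esub> u \<in> N"
      using submoduleE(4)[OF N a v(2)] a u by (simp add: smult_diff)
    then show ?thesis using coset_eq_iff[OF N] a u v by simp
  qed
  then have "(\<Union>v\<in>N +>\<^bsub>M\<^esub> u. N +>\<^bsub>M\<^esub> (a \<odot>\<^bsub>M\<^esub> v)) = (\<Union>v\<in>N +>\<^bsub>M\<^esub> u. N +>\<^bsub>M\<^esub> (a \<odot>\<^bsub>M\<^esub> u))"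
    by (intro SUP_cong refl)
  moreover have "u \<in> N +>\<^bsub>M\<^esub> u"
    using mem_coset_iff[OF N u] u submodule_zero[OF N] by (simp add: M.minus_eq M.r_neg)
  ultimately show ?thesis unfolding FactModule_def by (simp add: SUP_constant) blast
qed

lemma nonzerodivisor_on_FactModule_iff:
  assumes N: "submodule N R M"
  shows "nonzerodivisor_on R (FactModule M N) a \<longleftrightarrow> a \<in> carrier R \<and> regular_mod N a"
  unfolding nonzerodivisor_on_def regular_mod_def
  by (auto simp: carrier_FactModule zero_FactModule smult_FactModule[OF N] coset_eq_zero_iff[OF N])

lemma assoc_primes_FactModule:
  assumes N: "submodule N R M"
  shows "assoc_primes R (FactModule M N) = {P. primeideal P R \<and> (\<exists>w\<in>carrier M. P = colon N w)}"
proof -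
  have "{a \<in> carrier R. a \<odot>\<^bsub>FactModule M N\<^esub> (N +>\<^bsub>M\<^esub> w) = \<zero>\<^bsub>FactModule M N\<^esub>} = colon N w"
    if w: "w \<in> carrier M" for w
    unfolding colon_def
  proof (intro Collect_cong conj_cong refl)
    fix a assume a: "a \<in> carrier R"
    show "a \<odot>\<^bsub>FactModule M N\<^esub> (N +>\<^bsub>M\<^esub> w) = \<zero>\<^bsub>FactModule M N\<^esub> \<longleftrightarrow> a \<odot>\<^bsub>M\<^esub> w \<in> N"
      unfolding zero_FactModule smult_FactModule[OF N a w]
      by (rule coset_eq_zero_iff[OF N smult_closed[OF a w]])
  qed
  then show ?thesis unfolding assoc_primes_def carrier_FactModule by auto
qed

lemma carrier_FactModule_eq_zero_iff:
  assumes N: "submodule N R M"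
  shows "carrier (FactModule M N) = {\<zero>\<^bsub>FactModule M N\<^esub>} \<longleftrightarrow> N = carrier M"
proof -
  have "carrier (FactModule M N) = {\<zero>\<^bsub>FactModule M N\<^esub>} \<longleftrightarrow> (\<forall>u\<in>carrier M. N +>\<^bsub>M\<^esub> u = N)"
    unfolding carrier_FactModule zero_FactModule using M.zero_closed coset_zero[OF N]
    by (metis (no_types, lifting) image_cong image_constant_conv image_eqI singletonD empty_iff)
  also have "\<dots> \<longleftrightarrow> N = carrier M" using coset_eq_zero_iff[OF N] submoduleE(1)[OF N] by blast
  finally show ?thesis .
qed

lemma submodule_FactModule_image:
  assumes N: "submodule N R M" and L: "submodule L R M"
  shows "submodule ((\<lambda>u. N +>\<^bsub>M\<^esub> u) ` L) R (FactModule M N)"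
proof -
  let ?F = "FactModule M N" and ?q = "\<lambda>u. N +>\<^bsub>M\<^esub> u"
  \<comment> \<open>The inverse is a definite description in the additive monoid of cosets, so
    existence and uniqueness of the opposite coset are checked by hand.\<close>
  have inv: "inv\<^bsub>add_monoid ?F\<^esub> (?q u) = ?q (\<ominus>\<^bsub>M\<^esub> u)" if u: "u \<in> carrier M" for u
    unfolding m_inv_def
  proof (rule the_equality)
    show "?q (\<ominus>\<^bsub>M\<^esub> u) \<in> carrier (add_monoid ?F) \<and>
        ?q u \<otimes>\<^bsub>add_monoid ?F\<^esub> ?q (\<ominus>\<^bsub>M\<^esub> u) = \<one>\<^bsub>add_monoid ?F\<^esub> \<and>
        ?q (\<ominus>\<^bsub>M\<^esub> u) \<otimes>\<^bsub>add_monoid ?F\<^esub> ?q u = \<one>\<^bsub>add_monoid ?F\<^esub>"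
      using u by (simp add: carrier_FactModule add_FactModule[OF N] zero_FactModule M.r_neg M.l_neg
          coset_zero[OF N])
  next
    fix y assume "y \<in> carrier (add_monoid ?F) \<and> ?q u \<otimes>\<^bsub>add_monoid ?F\<^esub> y = \<one>\<^bsub>add_monoid ?F\<^esub> \<and>
        y \<otimes>\<^bsub>add_monoid ?F\<^esub> ?q u = \<one>\<^bsub>add_monoid ?F\<^esub>"
    then obtain v where v: "v \<in> carrier M" "y = ?q v" "?q (v \<oplus>\<^bsub>M\<^esub> u) = N"
      using u by (auto simp: carrier_FactModule zero_FactModule add_FactModule[OF N])
    then have "v \<oplus>\<^bsub>M\<^esub> u \<in> N" using coset_eq_zero_iff[OF N] u by simp
    then have "v \<ominus>\<^bsub>M\<^esub> (\<ominus>\<^bsub>M\<^esub> u) \<in> N" using u v by (simp add: M.minus_eq)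
    then show "y = ?q (\<ominus>\<^bsub>M\<^esub> u)" using coset_eq_iff[OF N] u v by simp
  qed
  have Lc: "u \<in> carrier M" if "u \<in> L" for u using submodule_carrier[OF L that] .
  show ?thesis
  proof (intro submodule.intro subgroup.intro submodule_axioms.intro)
    show "?q ` L \<subseteq> carrier (add_monoid ?F)" using Lc by (auto simp: carrier_FactModule)
    show "\<one>\<^bsub>add_monoid ?F\<^esub> \<in> ?q ` L"
      using submodule_zero[OF L] coset_zero[OF N] by (force simp: zero_FactModule)
  next
    fix A B assume "A \<in> ?q ` L" "B \<in> ?q ` L"
    then show "A \<otimes>\<^bsub>add_monoid ?F\<^esub> B \<in> ?q ` L"
      using Lc submoduleE(5)[OF L] by (auto simp: add_FactModule[OF N])
  next
    fix A assume "A \<in> ?q ` L"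
    then show "inv\<^bsub>add_monoid ?F\<^esub> A \<in> ?q ` L" using inv Lc submoduleE(3)[OF L] by auto
  next
    fix a A assume "a \<in> carrier R" "A \<in> ?q ` L"
    then show "a \<odot>\<^bsub>?F\<^esub> A \<in> ?q ` L"
      using Lc submoduleE(4)[OF L] by (auto simp: smult_FactModule[OF N])
  qed
qed

lemma finite_length_chain_stable:
  assumes N: "submodule N R M" and fin: "module_length R (FactModule M N) \<noteq> \<infinity>"
    and V: "\<And>n. submodule (V n) R M" "\<And>n. N \<subseteq> V n" "\<And>n. V (Suc n) \<subseteq> V n"
  shows "\<exists>n. V (Suc n) = V n"
proof (rule ccontr)
  assume neg: "\<not> ?thesis"
  let ?q = "\<lambda>u. N +>\<^bsub>M\<^esub> u"
  have strict: "?q ` V (Suc n) \<subset> ?q ` V n" for n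
  proof -
    obtain u where u: "u \<in> V n" "u \<notin> V (Suc n)" using neg V(3)[of n] by blast
    have uc: "u \<in> carrier M" using submodule_carrier[OF V(1) u(1)] .
    have "?q u \<notin> ?q ` V (Suc n)"
    proof
      assume "?q u \<in> ?q ` V (Suc n)"
      then obtain v where v: "v \<in> V (Suc n)" "?q u = ?q v" by blast
      have vc: "v \<in> carrier M" using submodule_carrier[OF V(1) v(1)] .
      have "u \<ominus>\<^bsub>M\<^esub> v \<in> V (Suc n)" using coset_eq_iff[OF N uc vc] v V(2) by blast
      then show False using diff_mem_iff[OF V(1) v(1) uc] u by blast
    qed
    then show ?thesis using u V(3)[of n] by blast
  qed
  have "enat k \<le> module_length R (FactModule M N)" for k
  proof -
    \<comment> \<open>\<open>module_length\<close> counts ascending chains, so the descending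
      \<open>V\<close> is read backwards from index \<open>k\<close>.\<close>
    have "?q ` V (k - i) \<subset> ?q ` V (k - Suc i)" if "i < k" for i
      using strict[of "k - Suc i"] that by (simp add: Suc_diff_Suc)
    moreover have "submodule (?q ` V (k - i)) R (FactModule M N)" for i
      by (rule submodule_FactModule_image[OF N V(1)])
    ultimately show ?thesis unfolding module_length_def
      by (intro Sup_upper CollectI exI[of _ k] conjI refl exI[of _ "\<lambda>i. ?q ` V (k - i)"] allI impI)
  qed
  then show False using fin by (metis enat_ord_simps(1) not_enat_eq Suc_n_not_le_n)
qed

text \<open>For fixed \<open>u\<close>, the scalars that carry \<open>u\<close> into the span form
  an ideal; containing \<open>S\<close>, it contains \<open>Idl S\<close>.\<close>

lemma ideal_times_genideal:
  assumes S: "S \<subseteq> carrier R"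
  shows "ideal_times R M (Idl S) = submodule_span R M {a \<odot>\<^bsub>M\<^esub> u | a u. a \<in> S \<and> u \<in> carrier M}"
    (is "_ = submodule_span R M ?G")
proof
  have G: "?G \<subseteq> carrier M" using S by auto
  let ?W = "submodule_span R M ?G"
  have W: "submodule ?W R M" by (rule submodule_submodule_span[OF G])
  have "a \<odot>\<^bsub>M\<^esub> u \<in> ?W" if au: "a \<in> Idl S" "u \<in> carrier M" for a u
  proof -
    have "S \<subseteq> colon ?W u"
      using S au(2) submodule_span_upper[of ?G] unfolding colon_def by blast
    then have "Idl S \<subseteq> colon ?W u" by (rule R.genideal_minimal[OF ideal_colon[OF W au(2)]])
    then show ?thesis using au by (auto simp: colon_def)
  qed
  then show "ideal_times R M (Idl S) \<subseteq> ?W"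
    unfolding ideal_times_def by (intro submodule_span_least[OF W]) blast
  have I: "{a \<odot>\<^bsub>M\<^esub> u | a u. a \<in> Idl S \<and> u \<in> carrier M} \<subseteq> carrier M"
    using ideal.Icarr[OF R.genideal_ideal[OF S]] by auto
  show "?W \<subseteq> ideal_times R M (Idl S)"
    unfolding ideal_times_def
  proof (rule submodule_span_least[OF submodule_submodule_span[OF I]])
    have "?G \<subseteq> {a \<odot>\<^bsub>M\<^esub> u | a u. a \<in> Idl S \<and> u \<in> carrier M}" using R.genideal_self[OF S] by blast
    then show "?G \<subseteq> submodule_span R M {a \<odot>\<^bsub>M\<^esub> u | a u. a \<in> Idl S \<and> u \<in> carrier M}"
      using submodule_span_upper by (rule subset_trans)
  qed
qed

definition seq_submodule :: "(nat \<Rightarrow> 'a) \<Rightarrow> nat \<Rightarrow> 'c set" where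
  "seq_submodule x n = ideal_times R M (Idl (x ` {1..n}))"

lemma seq_quot_eq: "seq_quot R M x n = FactModule M (seq_submodule x n)"
  by (simp add: seq_quot_def seq_submodule_def)

context
  fixes x :: "nat \<Rightarrow> 'a" and n :: nat
  assumes x: "x ` {1..n} \<subseteq> carrier R"
begin

lemma seq_submodule_eq_span:
  "seq_submodule x n = submodule_span R M {x i \<odot>\<^bsub>M\<^esub> u | i u. i \<in> {1..n} \<and> u \<in> carrier M}"
proof -
  have "{a \<odot>\<^bsub>M\<^esub> u | a u. a \<in> x ` {1..n} \<and> u \<in> carrier M} =
      {x i \<odot>\<^bsub>M\<^esub> u | i u. i \<in> {1..n} \<and> u \<in> carrier M}" by blast
  then show ?thesis unfolding seq_submodule_def ideal_times_genideal[OF x] by simp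
qed

lemma submodule_seq_submodule: "submodule (seq_submodule x n) R M"
  unfolding seq_submodule_eq_span by (rule submodule_submodule_span) (use x in \<open>auto simp: image_subset_iff\<close>)

lemma smult_mem_seq_submodule:
  "i \<in> {1..n} \<Longrightarrow> u \<in> carrier M \<Longrightarrow> x i \<odot>\<^bsub>M\<^esub> u \<in> seq_submodule x n"
  unfolding seq_submodule_eq_span by (rule subsetD[OF submodule_span_upper]) blast

lemma seq_submodule_least:
  assumes "submodule L R M" "\<And>i u. i \<in> {1..n} \<Longrightarrow> u \<in> carrier M \<Longrightarrow> x i \<odot>\<^bsub>M\<^esub> u \<in> L"
  shows "seq_submodule x n \<subseteq> L"
  unfolding seq_submodule_eq_span by (rule submodule_span_least[OF assms(1)]) (use assms(2) in blast)

end

lemma seq_submodule_0: "seq_submodule x 0 = {\<zero>\<^bsub>M\<^esub>}"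
proof -
  have x: "x ` {1..0} \<subseteq> carrier R" by simp
  show ?thesis
    using seq_submodule_least[OF x submodule_singleton_zero]
      submodule_zero[OF submodule_seq_submodule[OF x]] by auto
qed

text \<open>The link between quotients by a generated ideal and the recursion of
  \<open>depth_ge\<close>, which adds one element at a time.\<close>

lemma seq_submodule_Suc:
  assumes x: "x ` {1..Suc n} \<subseteq> carrier R"
  shows "seq_submodule x (Suc n) = plus_multiples (seq_submodule x n) (x (Suc n))"
proof
  have x': "x ` {1..n} \<subseteq> carrier R" "x (Suc n) \<in> carrier R" using x by auto
  have N: "submodule (seq_submodule x n) R M" using submodule_seq_submodule[OF x'(1)] .
  note S = submodule_seq_submodule[OF x]
  show "seq_submodule x (Suc n) \<subseteq> plus_multiples (seq_submodule x n) (x (Suc n))"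
  proof (rule seq_submodule_least[OF x submodule_plus_multiples[OF N x'(2)]])
    fix i u assume "i \<in> {1..Suc n}" "u \<in> carrier M"
    then show "x i \<odot>\<^bsub>M\<^esub> u \<in> plus_multiples (seq_submodule x n) (x (Suc n))"
      using smult_mem_seq_submodule[OF x'(1)] plus_multiples_upper[OF N x'(2)] smult_mem_plus_multiples[OF N x'(2)]
      by (cases "i = Suc n") auto
  qed
  show "plus_multiples (seq_submodule x n) (x (Suc n)) \<subseteq> seq_submodule x (Suc n)"
  proof (rule plus_multiples_least[OF S])
    show "seq_submodule x n \<subseteq> seq_submodule x (Suc n)"
      by (rule seq_submodule_least[OF x'(1) S]) (use smult_mem_seq_submodule[OF x] in simp)
  qed (use smult_mem_seq_submodule[OF x] in simp)
qed

lemma ideal_annihilator: "ideal (annihilator R M) R"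
proof -
  have "annihilator R M = \<Inter>(colon {\<zero>\<^bsub>M\<^esub>} ` carrier M)"
    unfolding annihilator_def colon_def by auto
  moreover have "ideal (\<Inter>(colon {\<zero>\<^bsub>M\<^esub>} ` carrier M)) R"
    by (rule R.i_Intersect) (use ideal_colon[OF submodule_singleton_zero] in auto)
  ultimately show ?thesis by simp
qed

lemma annihilator_subset_colon: "submodule N R M \<Longrightarrow> u \<in> carrier M \<Longrightarrow> annihilator R M \<subseteq> colon N u"
  using submodule_zero by (auto simp: annihilator_def colon_def)

lemma regular_sequence_iff:
  assumes x: "x ` {1..n} \<subseteq> carrier R"
  shows "regular_sequence R M x n \<longleftrightarrow>
    (\<forall>i<n. regular_mod (seq_submodule x i) (x (Suc i))) \<and> seq_submodule x n \<noteq> carrier M"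
proof -
  have sub: "submodule (seq_submodule x i) R M" if "i \<le> n" for i
    by (rule submodule_seq_submodule) (use x that in auto)
  have "(\<forall>i\<in>{1..n}. nonzerodivisor_on R (seq_quot R M x (i - 1)) (x i)) \<longleftrightarrow>
      (\<forall>i<n. nonzerodivisor_on R (seq_quot R M x i) (x (Suc i)))"
    by (metis Suc_leI Suc_le_mono atLeastAtMost_iff diff_Suc_1 le_add1 less_eq_Suc_le
        not0_implies_Suc not_one_le_zero plus_1_eq_Suc)
  also have "\<dots> \<longleftrightarrow> (\<forall>i<n. regular_mod (seq_submodule x i) (x (Suc i)))"
    using nonzerodivisor_on_FactModule_iff[OF sub] x by (auto simp: seq_quot_eq)
  finally show ?thesis
    unfolding regular_sequence_def using carrier_FactModule_eq_zero_iff[OF sub[of n]]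
    by (simp add: seq_quot_eq)
qed

end

context local_noetherian_module
begin

text \<open>The hypothesis on \<open>L\<close> expresses that \<open>N\<close> is inside P M. For t
  in the maximal ideal but outside \<open>P\<close>, finite length makes the submodules
  \<open>N\<close> + t^n M stationary, and Nakayama then puts t^n M inside \<open>N\<close>, hence
  inside P M. This is impossible for a prime in the support.\<close>

lemma eq_max_ideal_if_finite_length:
  assumes N: "submodule N R M" and fin: "module_length R (FactModule M N) \<noteq> \<infinity>"
    and P: "primeideal P R" "annihilator R M \<subseteq> P"
    and NP: "\<And>L. \<lbrakk>submodule L R M; \<And>p u. p \<in> P \<Longrightarrow> u \<in> carrier M \<Longrightarrow> p \<odot>\<^bsub>M\<^esub> u \<in> L\<rbrakk> \<Longrightarrow> N \<subseteq> L"
  shows "P = max_ideal R"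
proof (rule ccontr)
  assume "P \<noteq> max_ideal R"
  then obtain t where t: "t \<in> max_ideal R" "t \<notin> P" using primeideal_subset_max_ideal[OF P(1)] by blast
  have tc: "t \<in> carrier R" using max_ideal_carrier t by blast
  define V where "V n = plus_multiples N (t [^] (n::nat))" for n
  have V: "submodule (V n) R M" for n unfolding V_def using submodule_plus_multiples[OF N] tc by simp
  have NV: "N \<subseteq> V n" for n unfolding V_def using plus_multiples_upper[OF N] tc by simp
  have tV: "(t [^] n) \<odot>\<^bsub>M\<^esub> u \<in> V n" if "u \<in> carrier M" for n u
    unfolding V_def using smult_mem_plus_multiples[OF N _ that] tc by simp
  have anti: "V (Suc n) \<subseteq> V n" for n
  proof -
    have "(t [^] Suc n) \<odot>\<^bsub>M\<^esub> u \<in> V n" if "u \<in> carrier M" for u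
      using tV[of "t \<odot>\<^bsub>M\<^esub> u" n] that tc by (simp add: smult_assoc1)
    then show ?thesis unfolding V_def[of "Suc n"] using plus_multiples_least[OF V NV] by blast
  qed
  obtain n where n: "V (Suc n) = V n" using finite_length_chain_stable[of N V, OF N fin V NV anti] by blast
  have "V n \<subseteq> N <+>\<^bsub>M\<^esub> multiples t (V n)"
  proof
    fix w assume "w \<in> V n"
    then have "w \<in> plus_multiples N (t [^] Suc n)" using n unfolding V_def by simp
    then obtain a u where au: "a \<in> N" "u \<in> carrier M" "w = a \<oplus>\<^bsub>M\<^esub> (t [^] Suc n) \<odot>\<^bsub>M\<^esub> u"
      unfolding plus_multiples_def mem_add_multiples_iff by blast
    have "(t [^] Suc n) \<odot>\<^bsub>M\<^esub> u = t \<odot>\<^bsub>M\<^esub> ((t [^] n) \<odot>\<^bsub>M\<^esub> u)"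
      using smult_left_commute[of "t [^] n" t u] au tc by (simp add: smult_assoc1)
    then show "w \<in> N <+>\<^bsub>M\<^esub> multiples t (V n)"
      unfolding mem_add_multiples_iff using au tV[OF au(2)] by metis
  qed
  then have VN: "V n \<subseteq> N" by (rule nakayama_local[OF t(1) N V])
  have "t [^] k \<notin> P" for k :: nat
  proof (induction k)
    case 0
    then show ?case using primeideal.one_notin[OF P(1)] by simp
  next
    case (Suc k)
    then show ?case using primeideal.I_prime[OF P(1), of "t [^] k" t] t tc by auto
  qed
  then have "t [^] n \<in> carrier R - P" using tc by simp
  then obtain L u where L: "submodule L R M" "\<And>p u. p \<in> P \<Longrightarrow> u \<in> carrier M \<Longrightarrow> p \<odot>\<^bsub>M\<^esub> u \<in> L"
    "u \<in> carrier M" "(t [^] n) \<odot>\<^bsub>M\<^esub> u \<notin> L"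
    using ex_support_submodule[OF P] by blast
  then show False using NP[OF L(1,2)] VN tV[OF L(3), of n] by blast
qed

text \<open>The induction starts at the end of the sequence: after the first \<open>n - k\<close>
  elements, \<open>k\<close> remain.\<close>

lemma depth_ge_if_regular_sequence:
  assumes x: "x ` {1..n} \<subseteq> max_ideal R" and reg: "regular_sequence R M x n"
  shows "depth_ge n {\<zero>\<^bsub>M\<^esub>}"
proof -
  have xc: "x ` {1..n} \<subseteq> carrier R" using x max_ideal_carrier by blast
  note r = reg[unfolded regular_sequence_iff[OF xc]]
  have "depth_ge k (seq_submodule x (n - k))" if "k \<le> n" for k
    using that
  proof (induction k)
    case 0
    then show ?case using r by simp
  next
    case (Suc k)
    define i where "i = n - Suc k"
    have i: "i < n" "n - k = Suc i" using Suc.prems unfolding i_def by auto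
    have "x ` {1..Suc i} \<subseteq> carrier R" using xc i by auto
    then have "depth_ge k (plus_multiples (seq_submodule x i) (x (Suc i)))"
      using Suc i seq_submodule_Suc by auto
    moreover have "x (Suc i) \<in> max_ideal R" using x i by auto
    ultimately show ?case using r i unfolding i_def[symmetric] by auto
  qed
  from this[of n] show ?thesis by (simp add: seq_submodule_0)
qed

text \<open>A regular sequence leaves M nonzero, so M has an associated prime. The chain above it,
  as long as the sequence, also lies above the annihilator and is counted by the dimension.\<close>

lemma depth_le_module_dim: "depth R M \<le> module_dim R M"
  unfolding depth_def
proof (rule Sup_least)
  fix k assume "k \<in> {enat n |n. \<exists>x. x ` {1..n} \<subseteq> max_ideal R \<and> regular_sequence R M x n}"
  then obtain n where k: "k = enat n" and n: "depth_ge n {\<zero>\<^bsub>M\<^esub>}"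
    using depth_ge_if_regular_sequence by blast
  note Z = submodule_singleton_zero
  obtain u where u: "u \<in> carrier M" "u \<notin> {\<zero>\<^bsub>M\<^esub>}"
    using depth_ge_neq_carrier[OF Z n] submoduleE(1)[OF Z] by blast
  obtain r where r: "r \<in> carrier R" "primeideal (colon {\<zero>\<^bsub>M\<^esub>} (r \<odot>\<^bsub>M\<^esub> u)) R"
    using ex_associated_prime_local[OF Z u] by blast
  obtain f where f: "prime_chain R f n" "f 0 = colon {\<zero>\<^bsub>M\<^esub>} (r \<odot>\<^bsub>M\<^esub> u)"
    using associated_prime_chain[OF Z n _ r(2)] r u by auto
  have "annihilator R M \<subseteq> f 0" using annihilator_subset_colon[OF Z] f r u by simp
  then show "k \<le> module_dim R M"
    unfolding module_dim_def k by (rule R.le_krull_dim_quot[OF ideal_annihilator f(1)])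
qed

end

theorem theorem11:
  fixes R :: "('a, 'r) ring_scheme" and M :: "('a, 'b, 'm) module_scheme"
    and y :: "nat \<Rightarrow> 'a" and d :: nat
  assumes "noetherian_local_ring R"
    and "module R M"
    and "fin_gen_module R M"
    and "carrier M \<noteq> {\<zero>\<^bsub>M\<^esub>}"
    and "module_dim R M = enat d"
    and "d \<ge> 1"
    and "reducing_system_of_parameters R M y d"
  shows "cohen_macaulay R M \<longleftrightarrow> nonzerodivisor_on R (seq_quot R M y (d - 1)) (y d)"
proof -
  interpret R: noetherian_local_ring R by fact
  interpret noetherian_module R M
    using noetherian_module_if_fin_gen[OF R.noetherian_ring_axioms assms(2,3)] .
  interpret local_noetherian_module R M by unfold_locales
  let ?N = "seq_submodule y"
  have y: "y ` {1..d} \<subseteq> max_ideal R" and fin: "module_length R (seq_quot R M y d) \<noteq> \<infinity>"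
    and reducing: "\<And>i P. \<lbrakk>i \<in> {1..d - 1}; P \<in> assoc_primes R (seq_quot R M y (i - 1));
      krull_dim (R Quot P) = enat (d - i)\<rbrakk> \<Longrightarrow> y i \<notin> P"
    using assms(7) unfolding reducing_system_of_parameters_def system_of_parameters_def by blast+
  have yc: "y ` {1..i} \<subseteq> carrier R" if "i \<le> d" for i
    using y max_ideal_carrier that by (auto simp: image_subset_iff)
  have ym: "y (Suc i) \<in> max_ideal R" if "i < d" for i using y that by auto
  have N: "submodule (?N i) R M" if "i \<le> d" for i using submodule_seq_submodule[OF yc[OF that]] .
  have N_Suc: "?N (Suc i) = plus_multiples (?N i) (y (Suc i))" if "i < d" for i
    using seq_submodule_Suc[of y i] yc[of "Suc i"] that by auto
  \<comment> \<open>The height theorem is applied to the d - i remaining parameters: a prime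
    containing them and \<open>f 0\<close> contains all of y_1, ..., y_d, and finite length makes it
    maximal.\<close>
  have bound: "k \<le> d - i"
    if i: "i \<le> d" and f: "prime_chain R f k" "annihilator R M \<subseteq> f 0" "y ` {1..i} \<subseteq> f 0" for i f k
  proof -
    have "k \<le> card (y ` {Suc i..d})"
    proof (rule R.prime_chain_length_le[OF _ _ f(1)])
      show "y ` {Suc i..d} \<subseteq> max_ideal R" using y by auto
    next
      fix P assume P: "primeideal P R" "f 0 \<subseteq> P" "y ` {Suc i..d} \<subseteq> P"
      have yP: "y j \<in> P" if "j \<in> {1..d}" for j
        using that P(2,3) f(3) by (cases "j \<le> i") (auto simp: image_subset_iff)
      show "P = max_ideal R"
      proof (rule eq_max_ideal_if_finite_length[OF N[of d]])
        show "module_length R (FactModule M (?N d)) \<noteq> \<infinity>" using fin by (simp add: seq_quot_eq)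
        show "?N d \<subseteq> L" if "submodule L R M" "\<And>p u. p \<in> P \<Longrightarrow> u \<in> carrier M \<Longrightarrow> p \<odot>\<^bsub>M\<^esub> u \<in> L" for L
          by (rule seq_submodule_least[OF yc[of d] that(1)]) (use that(2) yP in auto)
      qed (use P f in auto)
    qed simp
    also have "\<dots> \<le> d - i" using card_image_le[of "{Suc i..d}" y] by simp
    finally show ?thesis .
  qed
  \<comment> \<open>Every associated prime of M / \<open>?N i\<close> contains the annihilator and
    y_1, ..., y_i; containing \<open>y (Suc i)\<close> as well lowers the bound by one.\<close>
  have bound_colon: "k \<le> d - Suc i"
    if i: "i < d" and w: "w \<in> carrier M" and yw: "y (Suc i) \<in> colon (?N i) w"
      and f: "prime_chain R f k" "colon (?N i) w \<subseteq> f 0" for i w f k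
  proof (rule bound[OF _ f(1)])
    have Ni: "submodule (?N i) R M" using N i by simp
    show "annihilator R M \<subseteq> f 0" using annihilator_subset_colon[OF Ni w] f(2) by blast
    have "y j \<in> colon (?N i) w" if "j \<in> {1..i}" for j
      using smult_mem_seq_submodule[OF yc[of i] that w] yc[of i] that i by (auto simp: colon_def)
    then have "y j \<in> f 0" if "j \<in> {1..Suc i}" for j
      using yw f(2) that by (cases "j = Suc i") (auto simp: subset_iff)
    then show "y ` {1..Suc i} \<subseteq> f 0" by blast
  qed (use i in simp)
  have top: "nonzerodivisor_on R (seq_quot R M y (d - 1)) (y d) \<longleftrightarrow> regular_mod (?N (d - 1)) (y d)"
    using nonzerodivisor_on_FactModule_iff[OF N[of "d - 1"]] yc[of d] assms(6) by (auto simp: seq_quot_eq)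
  show ?thesis
    unfolding top
  proof
    assume "cohen_macaulay R M"
    then have depth: "depth R M = enat d" using assms(5) by (simp add: cohen_macaulay_def)
    let ?D = "{enat n |n. \<exists>x. x ` {1..n} \<subseteq> max_ideal R \<and> regular_sequence R M x n}"
    \<comment> \<open>The supremum is reached: if all regular sequences were shorter than
      \<open>d\<close>, then \<open>d - 1\<close> would bound them, and this is strictly smaller
      because \<open>d\<close> is positive.\<close>
    have "\<exists>n x. d \<le> n \<and> x ` {1..n} \<subseteq> max_ideal R \<and> regular_sequence R M x n"
    proof (rule ccontr)
      assume neg: "\<not> ?thesis"
      have "Sup ?D \<le> enat (d - 1)"
      proof (rule Sup_least)
        fix k assume "k \<in> ?D"
        then obtain n x where n: "k = enat n" "x ` {1..n} \<subseteq> max_ideal R" "regular_sequence R M x n"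
          by blast
        then have "n < d" using neg not_le by metis
        with n(1) show "k \<le> enat (d - 1)" by simp
      qed
      then show False using depth assms(6) unfolding depth_def by simp
    qed
    then obtain n x where n: "d \<le> n" "x ` {1..n} \<subseteq> max_ideal R" "regular_sequence R M x n" by blast
    then have "enat n \<le> depth R M" unfolding depth_def by (intro Sup_upper) blast
    then have "n = d" using n(1) depth by simp
    then have depth_d: "depth_ge d {\<zero>\<^bsub>M\<^esub>}" using depth_ge_if_regular_sequence n by blast
    \<comment> \<open>An associated prime containing \<open>y (Suc i)\<close> would carry a chain of
      length d - i by depth, but at most d - i - 1 by height.\<close>
    have reg: "regular_mod (?N i) (y (Suc i))" if i: "i < d" and D: "depth_ge (d - i) (?N i)" for i
    proof (rule ccontr)
      have Ni: "submodule (?N i) R M" using N i by simp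
      assume "\<not> regular_mod (?N i) (y (Suc i))"
      then obtain w where w: "w \<in> carrier M" "primeideal (colon (?N i) w) R"
        "y (Suc i) \<in> colon (?N i) w"
        using zero_divisor_in_associated_prime[OF Ni max_ideal_carrier[OF ym[OF i]]] by blast
      obtain f where f: "prime_chain R f (d - i)" "f 0 = colon (?N i) w"
        using associated_prime_chain[OF Ni D w(1,2)] by blast
      then have "d - i \<le> d - Suc i" using bound_colon[OF i w(1,3) f(1)] by simp
      then show False using i by simp
    qed
    \<comment> \<open>Depth and regularity advance together: enough depth makes the next parameter
      regular, and dividing by it costs one unit of depth although the original regular sequence was
      a different one.\<close>
    have "depth_ge (d - i) (?N i)" if "i \<le> d" for i
      using that
    proof (induction i)
      case 0
      then show ?case using depth_d by (simp add: seq_submodule_0)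
    next
      case (Suc i)
      then have i: "i < d" and D: "depth_ge (Suc (d - Suc i)) (?N i)"
        by (simp_all add: Suc_diff_Suc del: depth_ge.simps)
      show ?case
        unfolding N_Suc[OF i]
        by (rule depth_ge_plus_multiples[OF N D ym[OF i] reg[OF i]])
          (use i D in \<open>simp_all add: Suc_diff_Suc del: depth_ge.simps\<close>)
    qed
    from reg[OF _ this[of "d - 1"]] show "regular_mod (?N (d - 1)) (y d)" using assms(6) by simp
  next
    assume last: "regular_mod (?N (d - 1)) (y d)"
    have ne: "?N i \<noteq> carrier M" if "i \<le> d" for i
      using that
    proof (induction i)
      case 0
      then show ?case using assms(4) by (simp add: seq_submodule_0)
    next
      case (Suc i)
      then show ?case using plus_multiples_neq_carrier[OF N _ ym, of i] N_Suc[of i] by simp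
    qed
    \<comment> \<open>\<open>i\<close> counts the parameters already divided out, so the base i = d
      - 1 is the hypothesis on \<open>y d\<close>. Depth is carried along because it supplies the
      long chains in the next step.\<close>
    have "regular_mod (?N i) (y (Suc i)) \<and> depth_ge (d - i) (?N i)" if "i \<le> d - 1" for i
      using that
    proof (induction rule: inc_induct)
      case base
      have "depth_ge (Suc 0) (?N (d - 1))"
        using last ne[of d] ym[of "d - 1"] N_Suc[of "d - 1"] assms(6) by auto
      then show ?case using last assms(6) by (simp del: depth_ge.simps)
    next
      case (step i)
      then have i: "i < d" "Suc i \<in> {1..d - 1}" by auto
      have Ni: "submodule (?N i) R M" using N i by simp
      have D: "depth_ge (d - Suc i) (plus_multiples (?N i) (y (Suc i)))" using step N_Suc[OF i(1)] by simp
      have reg: "regular_mod (?N i) (y (Suc i))"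
      proof (rule regular_mod_if_no_long_chains[OF Ni ym[OF i(1)] D])
        fix w f
        assume w: "w \<in> carrier M" "primeideal (colon (?N i) w) R" "y (Suc i) \<in> colon (?N i) w"
          and f: "prime_chain R f (d - Suc i)" "f 0 = colon (?N i) w"
        \<comment> \<open>The chain bounds the coheight of \<open>?Q\<close> from below and the
          height theorem bounds it from above by the same number; the reducing condition at index
          \<open>Suc i\<close> forbids this equality for a prime containing
          \<open>y (Suc i)\<close>.\<close>
        let ?Q = "colon (?N i) w"
        have Q: "ideal ?Q R" using ideal_colon[OF Ni w(1)] .
        have "enat (d - Suc i) \<le> krull_dim (R Quot ?Q)"
          using R.le_krull_dim_quot[OF Q f(1)] f(2) by simp
        moreover have "krull_dim (R Quot ?Q) \<le> enat (d - Suc i)"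
          by (rule R.krull_dim_quot_le[OF Q]) (rule bound_colon[OF i(1) w(1,3)])
        ultimately have "krull_dim (R Quot ?Q) = enat (d - Suc i)" by (rule antisym[rotated])
        moreover have "?Q \<in> assoc_primes R (seq_quot R M y (Suc i - 1))"
          using w assoc_primes_FactModule[OF Ni] by (auto simp: seq_quot_eq)
        ultimately show False using reducing[OF i(2)] w(3) by blast
      qed
      moreover have "depth_ge (Suc (d - Suc i)) (?N i)" using reg D ym[OF i(1)] by auto
      ultimately show ?case using i(1) by (simp add: Suc_diff_Suc del: depth_ge.simps)
    qed
    then have "regular_sequence R M y d"
      using regular_sequence_iff[OF yc[of d]] ne[of d] by auto
    then have "enat d \<le> depth R M" using y unfolding depth_def by (intro Sup_upper) blast
    then show "cohen_macaulay R M"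
      using depth_le_module_dim assms(5) by (simp add: cohen_macaulay_def)
  qed
qed

end
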